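(* Let $E=E(\mathbf{n},\mathbf{c})$ be a uniform Cantor set. Let $\mathbb{P}$ be an ultimately $1$-uniform $\mathbf{n}$-matching sequence of positive probability vectors and let $\mu_{\mathbb{P}}$ be the measure on $E$ determined by $\mathbb{P}$. Then $\mu_{\mathbb{P}}$ can be extended to a doubling measure on $[0,1]$ if and only if $\{n_kc_k\}_{k=1}^\infty\in\ell^1$.
   Context: Uniform Cantor set: let $\mathbf{n}=\{n_k\}_{k\ge1}$ be integers with $n_k\geq 2$ and $\mathbf{c}=\{c_k\}_{k\ge1}$ real numbers in $(0,1)$ with $(n_k-1)c_k<1$ for all $k$. Put $E_0=[0,1]$; $E_k$ is obtained from $E_{k-1}$ by deleting from every component $I$ of $E_{k-1}$ exactly $n_k-1$ open intervals, each of length $c_k|I|$, such that the remaining $n_k$ closed intervals are of equal length. Then $E(\mathbf{n},\mathbf{c})=\bigcap_{k\ge 0}E_k$. Components of $E_k$ are called components of level $k$. Words: $W_k=\{i_1\cdots i_k:1\le i_j\le n_j\}$, $W_0=\{\text{empty word}\}$, and $I_{\text{empty}}=[0,1]$. Inductively, for $w\in W_{k-1}$, $I_{w1},\dots,I_{wn_k}$ denote from left to right the $n_k$ components of level $k$ contained in $I_w$. A vector is a positive probability vector if its entries are all positive and sum to $1$. A positive probability vector $P=(p_1,\dots,p_q)$ is $C$-uniform ($C\ge1$) if $C^{-1}\le\frac{p_{i+1}+\cdots+p_{i+l}}{p_{j+1}+\cdots+p_{j+l}}\le C$ for all integers $i,j,l$ with $l\ge1$ and $0\le i\le j\le i+l\le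 j+l\le q$; in particular $P$ is $1$-uniform if and only if $p_1=\cdots=p_q$. A sequence $\{P_k\}$ is ultimately $C$-uniform if there is an integer $k_0\ge1$ such that $P_k$ is $C$-uniform for each $k\ge k_0$. A sequence $\mathbb{P}=\{P_k\}_{k\ge1}$ of positive probability vectors is $\mathbf{n}$-matching if $P_k=(p_{k,1},\dots,p_{k,n_k})$ has $n_k$ entries for each $k$. Then $\mu_{\mathbb{P}}$ is the unique Borel probability measure on $E(\mathbf{n},\mathbf{c})$ with $\mu_{\mathbb{P}}(I_{wi})=p_{k,i}\,\mu_{\mathbb{P}}(I_w)$ for all $k\ge1$, $w\in W_{k-1}$, $1\le i\le n_k$ (where $\mu_{\mathbb{P}}(I)$ means $\mu_{\mathbb{P}}(I\cap E)$). A Borel regular measure $\nu$ on a metric space $X$ is doubling if there is a constant $C\ge1$ with $0<\nu(B(x,2r))\le C\nu(B(x,r))<\infty$ for all $x\in X$ and $r>0$. A measure $\mu$ on $E$ can be extended to a doubling measure on $[0,1]$ if there is a doubling measure $\nu$ on $[0,1]$ whose restriction $\nu|_E$ to (Borel subsets of) $E$ equals $\mu$. $\ell^1$ is the set of real sequences $\{a_k\}_{k\ge1}$ with $\sum_k|a_k|<\infty$. *)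

theory Defs
  imports "HOL-Probability.Probability"
begin

section \<open>Uniform Cantor sets\<close>

text \<open>Sequences are indexed by \<open>k \<ge> 1\<close>; the value at index 0 is irrelevant.\<close>

definition uniform_cantor_params :: "(nat \<Rightarrow> nat) \<Rightarrow> (nat \<Rightarrow> real) \<Rightarrow> bool" where
  "uniform_cantor_params n c \<longleftrightarrow>
     (\<forall>k\<ge>1. 2 \<le> n k \<and> 0 < c k \<and> c k < 1 \<and> (real (n k) - 1) * c k < 1)"

text \<open>
  Endpoints of the \<open>i\<close>-th interval from the left (\<open>1 \<le> i \<le> N\<close>) that remains when \<open>N - 1\<close> open
  intervals of length \<open>\<gamma> L\<close> are deleted from \<open>[a, b]\<close>, \<open>L = b - a\<close>, so that the \<open>N\<close> remaining
  closed intervals have a common length \<open>d\<close>; necessarily \<open>N d + (N - 1) \<gamma> L = L\<close>.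
\<close>

definition sub_interval :: "nat \<Rightarrow> real \<Rightarrow> real \<times> real \<Rightarrow> nat \<Rightarrow> real \<times> real" where
  "sub_interval N \<gamma> = (\<lambda>(a, b) i.
     let L = b - a;
         d = (1 - (real N - 1) * \<gamma>) * L / real N;
         s = a + (real i - 1) * (d + \<gamma> * L)
     in (s, s + d))"

definition words :: "(nat \<Rightarrow> nat) \<Rightarrow> nat \<Rightarrow> nat list set" where
  "words n k = {w. length w = k \<and> (\<forall>j\<in>{1..k}. w ! (j - 1) \<in> {1..n j})}"

fun word_ends :: "(nat \<Rightarrow> nat) \<Rightarrow> (nat \<Rightarrow> real) \<Rightarrow> nat list \<Rightarrow> real \<times> real" where
  "word_ends n c w =
     (if w = [] then (0, 1)
      else sub_interval (n (length w)) (c (length w)) (word_ends n c (butlast w)) (last w))"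

declare word_ends.simps [simp del]

definition word_interval :: "(nat \<Rightarrow> nat) \<Rightarrow> (nat \<Rightarrow> real) \<Rightarrow> nat list \<Rightarrow> real set" where
  "word_interval n c w = {fst (word_ends n c w)..snd (word_ends n c w)}"

definition cantor_level :: "(nat \<Rightarrow> nat) \<Rightarrow> (nat \<Rightarrow> real) \<Rightarrow> nat \<Rightarrow> real set" where
  "cantor_level n c k = (\<Union>w\<in>words n k. word_interval n c w)"

definition uniform_cantor_set :: "(nat \<Rightarrow> nat) \<Rightarrow> (nat \<Rightarrow> real) \<Rightarrow> real set" where
  "uniform_cantor_set n c = (\<Inter>k. cantor_level n c k)"

section \<open>Positive probability vectors\<close>

text \<open>
  A vector \<open>(p\<^sub>1, \<dots>, p\<^sub>q)\<close> is a list, so \<open>p\<^sub>m\<close> is \<open>p ! (m - 1)\<close> and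
  \<open>p\<^bsub>i+1\<^esub> + \<dots> + p\<^bsub>i+l\<^esub>\<close> is the sum of \<open>p ! m\<close> over \<open>i \<le> m < i + l\<close>.
\<close>

definition positive_prob_vector :: "real list \<Rightarrow> bool" where
  "positive_prob_vector p \<longleftrightarrow> (\<forall>x\<in>set p. 0 < x) \<and> sum_list p = 1"

definition uniform_vector :: "real \<Rightarrow> real list \<Rightarrow> bool" where
  "uniform_vector C p \<longleftrightarrow>
     positive_prob_vector p \<and> C \<ge> 1 \<and>
     (\<forall>i j l. 1 \<le> l \<and> i \<le> j \<and> j \<le> i + l \<and> i + l \<le> j + l \<and> j + l \<le> length p \<longrightarrow>
        inverse C \<le> (\<Sum>m\<in>{i..<i + l}. p ! m) / (\<Sum>m\<in>{j..<j + l}. p ! m) \<and>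
        (\<Sum>m\<in>{i..<i + l}. p ! m) / (\<Sum>m\<in>{j..<j + l}. p ! m) \<le> C)"

definition ultimately_uniform :: "real \<Rightarrow> (nat \<Rightarrow> real list) \<Rightarrow> bool" where
  "ultimately_uniform C P \<longleftrightarrow> (\<exists>k0\<ge>1. \<forall>k\<ge>k0. uniform_vector C (P k))"

definition matching :: "(nat \<Rightarrow> nat) \<Rightarrow> (nat \<Rightarrow> real list) \<Rightarrow> bool" where
  "matching n P \<longleftrightarrow> (\<forall>k\<ge>1. positive_prob_vector (P k) \<and> length (P k) = n k)"

section \<open>Measures\<close>

definition is_cantor_measure ::
  "(nat \<Rightarrow> nat) \<Rightarrow> (nat \<Rightarrow> real) \<Rightarrow> (nat \<Rightarrow> real list) \<Rightarrow> real measure \<Rightarrow> bool" where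
  "is_cantor_measure n c P \<mu> \<longleftrightarrow>
     sets \<mu> = sets (restrict_space borel (uniform_cantor_set n c)) \<and>
     prob_space \<mu> \<and>
     (\<forall>k\<ge>1. \<forall>w\<in>words n (k - 1). \<forall>i\<in>{1..n k}.
        emeasure \<mu> (word_interval n c (w @ [i]) \<inter> uniform_cantor_set n c) =
          ennreal (P k ! (i - 1)) *
          emeasure \<mu> (word_interval n c w \<inter> uniform_cantor_set n c))"

text \<open>
  Doubling measures on a subspace \<open>X\<close>; balls are open balls of \<open>X\<close>. The measure is given on the
  Borel sets of \<open>X\<close>; Borel regularity of the outer measure \<^const>\<open>outer_measure_of\<close> it induces is
  then automatic, see \<open>outer_measure_of_attain\<close>.
\<close>

definition doubling_measure_on :: "'a::metric_space set \<Rightarrow> 'a measure \<Rightarrow> bool" where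
  "doubling_measure_on X \<nu> \<longleftrightarrow>
     sets \<nu> = sets (restrict_space borel X) \<and>
     (\<exists>C::real. C \<ge> 1 \<and> (\<forall>x\<in>X. \<forall>r>0.
        0 < emeasure \<nu> (ball x (2 * r) \<inter> X) \<and>
        emeasure \<nu> (ball x (2 * r) \<inter> X) \<le> ennreal C * emeasure \<nu> (ball x r \<inter> X) \<and>
        ennreal C * emeasure \<nu> (ball x r \<inter> X) < \<infinity>))"

definition extends_to_doubling_measure ::
  "real set \<Rightarrow> real measure \<Rightarrow> bool" where
  "extends_to_doubling_measure E \<mu> \<longleftrightarrow>
     (\<exists>\<nu>. doubling_measure_on {0..1} \<nu> \<and> restrict_space \<nu> E = \<mu>)"

definition in_l1 :: "(nat \<Rightarrow> real) \<Rightarrow> bool" where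
  "in_l1 a \<longleftrightarrow> summable (\<lambda>k. \<bar>a (Suc k)\<bar>)"

section \<open>The words describe the components of each level\<close>

lemma word_ends_Nil: "word_ends n c [] = (0, 1)"
  by (simp add: word_ends.simps)

lemma word_ends_snoc:
  "word_ends n c (w @ [i]) =
     sub_interval (n (Suc (length w))) (c (Suc (length w))) (word_ends n c w) i"
  by (subst word_ends.simps) simp

lemma words_0: "words n 0 = {[]}"
  by (auto simp: words_def)

lemma words_Suc: "words n (Suc k) = (\<lambda>(w, i). w @ [i]) ` (words n k \<times> {1..n (Suc k)})"
proof (intro set_eqI iffI)
  fix v assume v: "v \<in> words n (Suc k)"
  then have "length v = Suc k" by (simp add: words_def)
  then obtain w i where vw: "v = w @ [i]" "length w = k"
    by (auto simp: length_Suc_conv_rev)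
  have *: "v ! (j - 1) \<in> {1..n j}" if "j \<in> {1..Suc k}" for j
    using v that unfolding words_def by blast
  have "w ! (j - 1) \<in> {1..n j}" if "j \<in> {1..k}" for j
  proof -
    have "j - 1 < length w" using that vw by auto
    then show ?thesis using *[of j] that by (simp add: vw(1) nth_append)
  qed
  moreover have "i \<in> {1..n (Suc k)}"
    using *[of "Suc k"] vw by (auto simp: nth_append)
  ultimately show "v \<in> (\<lambda>(w, i). w @ [i]) ` (words n k \<times> {1..n (Suc k)})"
    using vw by (auto simp: words_def)
next
  fix v assume "v \<in> (\<lambda>(w, i). w @ [i]) ` (words n k \<times> {1..n (Suc k)})"
  then obtain w i where v: "v = w @ [i]" "w \<in> words n k" "i \<in> {1..n (Suc k)}" by auto
  have *: "w ! (j - 1) \<in> {1..n j}" if "j \<in> {1..k}" for j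
    using v(2) that unfolding words_def by blast
  have len: "length w = k" using v(2) by (simp add: words_def)
  have "v ! (j - 1) \<in> {1..n j}" if j: "j \<in> {1..Suc k}" for j
  proof (cases "j = Suc k")
    case True
    then show ?thesis using v len by (simp add: nth_append)
  next
    case False
    then have "j \<in> {1..k}" using j by auto
    then have "j - 1 < length w" using len by auto
    then show ?thesis using *[OF \<open>j \<in> {1..k}\<close>] v(1) by (simp add: nth_append)
  qed
  then show "v \<in> words n (Suc k)" using v(1) len unfolding words_def by simp
qed

lemma finite_words: "finite (words n k)"
  by (induction k) (auto simp: words_0 words_Suc)

locale cantor_step =
  fixes N :: nat and \<gamma> a b :: real
  assumes N: "2 \<le> N" and \<gamma>: "0 < \<gamma>" "(real N - 1) * \<gamma> < 1" and ab: "a < b"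
begin

abbreviation "lo i \<equiv> fst (sub_interval N \<gamma> (a, b) i)"
abbreviation "hi i \<equiv> snd (sub_interval N \<gamma> (a, b) i)"

definition "d = (1 - (real N - 1) * \<gamma>) * (b - a) / real N"

lemma d_pos: "0 < d"
  unfolding d_def using N \<gamma> ab by (intro divide_pos_pos mult_pos_pos) auto

lemma lo_eq: "lo i = a + (real i - 1) * (d + \<gamma> * (b - a))"
  and hi_eq: "hi i = lo i + d"
  by (simp_all add: sub_interval_def Let_def d_def)

lemma lo_1: "lo 1 = a"
  by (simp add: lo_eq)

lemma hi_N: "hi N = b"
proof -
  have "real N * d = (1 - (real N - 1) * \<gamma>) * (b - a)"
    using N by (simp add: d_def)
  then show ?thesis
    unfolding hi_eq lo_eq by (simp add: algebra_simps)
qed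

lemma gap_length: "lo (Suc i) - hi i = \<gamma> * (b - a)"
  by (simp add: hi_eq lo_eq algebra_simps)

lemma lo_mono: "i \<le> j \<Longrightarrow> lo i \<le> lo j"
  unfolding lo_eq using d_pos \<gamma> ab by (intro add_left_mono mult_right_mono) auto

lemma lo_less_hi: "lo i < hi i"
  using d_pos by (simp add: hi_eq)

lemma hi_less_lo: assumes "i < j" shows "hi i < lo j"
proof -
  have "0 < \<gamma> * (b - a)" using \<gamma> ab by simp
  then have "hi i < lo (Suc i)" using gap_length[of i] by linarith
  also have "\<dots> \<le> lo j" using assms by (intro lo_mono) simp
  finally show ?thesis .
qed

lemma disjoint: "i \<noteq> j \<Longrightarrow> {lo i..hi i} \<inter> {lo j..hi j} = {}"
  using hi_less_lo[of i j] hi_less_lo[of j i] by (cases i j rule: linorder_cases) auto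

lemma subset: assumes "i \<in> {1..N}" shows "{lo i..hi i} \<subseteq> {a..b}"
proof -
  have "lo 1 \<le> lo i" "lo i \<le> lo N" using assms by (auto intro!: lo_mono)
  then show ?thesis using lo_1 hi_N hi_eq[of i] hi_eq[of N] by auto
qed

lemma deleted: "{a..b} - (\<Union>i\<in>{1..N}. {lo i..hi i}) = (\<Union>i\<in>{1..<N}. {hi i<..<lo (Suc i)})"
proof (intro set_eqI iffI)
  fix x assume x: "x \<in> {a..b} - (\<Union>i\<in>{1..N}. {lo i..hi i})"
  define i where "i = Max {i\<in>{1..N}. lo i \<le> x}"
  have fin: "finite {i\<in>{1..N}. lo i \<le> x}" by simp
  have ne: "1 \<in> {i\<in>{1..N}. lo i \<le> x}" using x N lo_1 by auto
  have i: "i \<in> {1..N}" "lo i \<le> x"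
    using Max_in[OF fin] ne unfolding i_def by blast+
  have "hi i < x" using x i(2) i(1) by (meson DiffD2 UN_I atLeastAtMost_iff not_le_imp_less)
  then have "i \<noteq> N" using hi_N x by auto
  then have "i < N" using i by auto
  have "x < lo (Suc i)"
  proof (rule ccontr)
    assume "\<not> x < lo (Suc i)"
    then have "Suc i \<in> {i\<in>{1..N}. lo i \<le> x}" using \<open>i < N\<close> by auto
    then have "Suc i \<le> i" unfolding i_def using Max_ge[OF fin] by blast
    then show False by simp
  qed
  then show "x \<in> (\<Union>i\<in>{1..<N}. {hi i<..<lo (Suc i)})"
    using \<open>hi i < x\<close> \<open>i < N\<close> i by auto
next
  fix x assume "x \<in> (\<Union>i\<in>{1..<N}. {hi i<..<lo (Suc i)})"
  then obtain i where i: "i \<in> {1..<N}" "hi i < x" "x < lo (Suc i)" by auto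
  have "x \<notin> {lo j..hi j}" for j
  proof (cases "j \<le> i")
    case True
    then have "hi j \<le> hi i" using lo_mono hi_eq by simp
    then show ?thesis using i by auto
  next
    case False
    then have "lo (Suc i) \<le> lo j" by (intro lo_mono) simp
    then show ?thesis using i by auto
  qed
  moreover have "x \<in> {a..b}"
    using i subset[of i] subset[of "Suc i"] lo_less_hi[of i] lo_less_hi[of "Suc i"] by auto
  ultimately show "x \<in> {a..b} - (\<Union>i\<in>{1..N}. {lo i..hi i})" by auto
qed

end

lemma word_ends_less:
  assumes "uniform_cantor_params n c"
  shows "fst (word_ends n c w) < snd (word_ends n c w)"
proof (induction w rule: rev_induct)
  case Nil
  then show ?case by (simp add: word_ends_Nil)
next
  case (snoc i w)
  then interpret cantor_step "n (Suc (length w))" "c (Suc (length w))"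
      "fst (word_ends n c w)" "snd (word_ends n c w)"
    using assms by unfold_locales (auto simp: uniform_cantor_params_def)
  show ?case using lo_less_hi by (simp add: word_ends_snoc)
qed

lemma word_step:
  assumes "uniform_cantor_params n c"
  shows "cantor_step (n (Suc (length w))) (c (Suc (length w)))
      (fst (word_ends n c w)) (snd (word_ends n c w))"
  using assms word_ends_less[OF assms, of w]
  by unfold_locales (auto simp: uniform_cantor_params_def)

lemma word_interval_snoc_subset:
  assumes "uniform_cantor_params n c" "i \<in> {1..n (Suc (length w))}"
  shows "word_interval n c (w @ [i]) \<subseteq> word_interval n c w"
  using cantor_step.subset[OF word_step[OF assms(1)] assms(2)]
  by (simp add: word_interval_def word_ends_snoc)

lemma word_interval_disjoint:
  assumes "uniform_cantor_params n c" "v \<in> words n k" "w \<in> words n k" "v \<noteq> w"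
  shows "word_interval n c v \<inter> word_interval n c w = {}"
  using assms(2-4)
proof (induction k arbitrary: v w)
  case 0
  then show ?case by (simp add: words_0)
next
  case (Suc k)
  obtain v' i w' j where eq: "v = v' @ [i]" "w = w' @ [j]"
    and mem: "v' \<in> words n k" "w' \<in> words n k" "i \<in> {1..n (Suc k)}" "j \<in> {1..n (Suc k)}"
    using Suc.prems(1,2) unfolding words_Suc by auto
  have len: "length v' = k" "length w' = k" using mem by (auto simp: words_def)
  show ?case
  proof (cases "v' = w'")
    case True
    then have "i \<noteq> j" using eq Suc.prems by auto
    then show ?thesis
      using cantor_step.disjoint[OF word_step[OF assms(1), of w'], of i j] True
      by (simp add: eq word_interval_def word_ends_snoc)
  next
    case False
    have "word_interval n c v \<subseteq> word_interval n c v'" "word_interval n c w \<subseteq> word_interval n c w'"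
      using word_interval_snoc_subset[OF assms(1)] mem len by (auto simp: eq)
    then show ?thesis using Suc.IH[OF mem(1,2) False] by blast
  qed
qed

lemma components_finite_disjoint_Union:
  assumes fin: "finite F" and disj: "pairwise disjnt F"
    and F: "\<And>C. C \<in> F \<Longrightarrow> closed C \<and> connected C \<and> C \<noteq> {}"
  shows "components (\<Union>F) = F"
proof -
  have 1: "C \<in> components (\<Union>F)" if C: "C \<in> F" for C
  proof -
    obtain K where K: "K \<in> components (\<Union>F)" "C \<subseteq> K"
      using exists_component_superset[of C "\<Union>F"] F[OF C] C by blast
    let ?R = "\<Union>(F - {C})"
    have "closed ?R" using fin F by (intro closed_Union) auto
    moreover have "C \<inter> ?R = {}"
      using disj C unfolding pairwise_def disjnt_def by blast
    moreover have "K \<subseteq> C \<union> ?R" using in_components_subset[OF K(1)] by blast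
    moreover have "C \<inter> K \<noteq> {}" using K F[OF C] by blast
    ultimately have "?R \<inter> K = {}"
      using connected_closedD[OF in_components_connected[OF K(1)], of C ?R] F[OF C] by blast
    then have "K = C" using \<open>K \<subseteq> C \<union> ?R\<close> K(2) by blast
    then show ?thesis using K by simp
  qed
  have "K \<in> F" if K: "K \<in> components (\<Union>F)" for K
  proof -
    obtain x where "x \<in> K" using in_components_nonempty[OF K] by blast
    moreover obtain C where "C \<in> F" "x \<in> C"
      using \<open>x \<in> K\<close> in_components_subset[OF K] by blast
    ultimately have "K = C" using components_eq[OF K 1[OF \<open>C \<in> F\<close>]] by blast
    then show ?thesis using \<open>C \<in> F\<close> by simp
  qed
  then show ?thesis using 1 by blast
qed

lemma components_cantor_level:
  assumes "uniform_cantor_params n c"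
  shows "components (cantor_level n c k) = word_interval n c ` words n k"
  unfolding cantor_level_def
proof (rule components_finite_disjoint_Union)
  show "finite (word_interval n c ` words n k)" by (simp add: finite_words)
  show "pairwise disjnt (word_interval n c ` words n k)"
    using word_interval_disjoint[OF assms] unfolding pairwise_def disjnt_def by blast
  fix C assume "C \<in> word_interval n c ` words n k"
  then show "closed C \<and> connected C \<and> C \<noteq> {}"
    using word_ends_less[OF assms] by (auto simp: word_interval_def less_imp_le)
qed

end

theory Submission
  imports Defs
begin

text \<open>
  Since \<open>n\<^sub>k \<ge> 2\<close>, summability of \<open>n\<^sub>k c\<^sub>k\<close> is equivalent to summability of \<open>(n\<^sub>k - 1) c\<^sub>k\<close>,
  the proportion of Lebesgue measure removed at step \<open>k\<close>; so it says that \<open>E\<close> has positive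
  Lebesgue measure. From some level \<open>K\<close> on, the Cantor measure divides the mass of a component
  equally among its children. The locale \<open>equidistributed_measure\<close> isolates this property, and both implications rest on comparing such a measure with length.

  \<^bold>\<open>A doubling extension forces summability.\<close> In a component of level at least \<open>K\<close> with mass
  \<open>m\<close>, the window that occupies the
  fraction \<open>t\<close> of its length at the right end has mass at least \<open>t m / 2\<close>
  (\<open>measure_right_end_ge\<close>): the bound is linear in \<open>t\<close>, whereas doubling by itself would
  give only some power of \<open>t\<close>. Let \<open>\<nu>\<close> be a doubling extension with constant \<open>C\<close>. A deleted gap of
  \<open>I\<^sub>w\<close>, \<open>w\<close> of length \<open>k \<ge> K\<close>, is a ball, and the ball of twice its radius contains the right end of the
  child on its left, up to a quarter of the length of the gap. Hence one application of doubling gives the gap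
  at least \<open>c\<^bsub>k+1\<^esub> \<mu>(I\<^sub>w) / (8 C)\<close> (\<open>gap_measure_ge\<close>). Summation over all gaps of the level shows that
  \<open>n\<^bsub>k+1\<^esub> c\<^bsub>k+1\<^esub>\<close> is at most a constant multiple of \<open>\<nu>(E\<^sub>k) - \<nu>(E\<^bsub>k+1\<^esub>)\<close>, and these differences telescope.

  \<^bold>\<open>Summability gives a doubling extension.\<close> If \<open>E\<close> has positive Lebesgue measure, Lebesgue measure
  restricted to \<open>E\<close> is equidistributed too (\<open>equidistributed_lebesgue\<close>). Two equidistributed
  measures are bounded by constant multiples of each other on all Borel sets
  (\<open>equidistributed_measures_comparable\<close>): on components of level at least \<open>K\<close> by induction, on
  open sets by exhaustion with components, and on Borel sets by outer regularity. Consequently the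
  measure that is \<open>\<mu>\<close> on \<open>E\<close> and Lebesgue measure off \<open>E\<close> is comparable to Lebesgue measure on the
  unit interval, hence doubling.
\<close>

section \<open>Lengths and nesting of the word intervals\<close>

locale uniform_cantor =
  fixes n :: "nat \<Rightarrow> nat" and c :: "nat \<Rightarrow> real"
  assumes params: "uniform_cantor_params n c"
begin

abbreviation I :: "nat list \<Rightarrow> real set" where "I \<equiv> word_interval n c"
abbreviation left :: "nat list \<Rightarrow> real" where "left w \<equiv> fst (word_ends n c w)"
abbreviation right :: "nat list \<Rightarrow> real" where "right w \<equiv> snd (word_ends n c w)"
abbreviation W :: "nat \<Rightarrow> nat list set" where "W \<equiv> words n"
abbreviation level :: "nat \<Rightarrow> real set" where "level \<equiv> cantor_level n c"
abbreviation E :: "real set" where "E \<equiv> uniform_cantor_set n c"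

definition level_length :: "nat \<Rightarrow> real" where
  "level_length k = (\<Prod>j=1..k. (1 - (real (n j) - 1) * c j) / real (n j))"

lemma n_ge_2: "2 \<le> n (Suc k)"
  and c_pos: "0 < c (Suc k)"
  and removed_less_1: "(real (n (Suc k)) - 1) * c (Suc k) < 1"
  using params by (auto simp: uniform_cantor_params_def)

lemma removed_pos: "0 < (real (n (Suc k)) - 1) * c (Suc k)"
  using n_ge_2[of k] c_pos[of k] by simp

lemma level_length_0: "level_length 0 = 1"
  by (simp add: level_length_def)

lemma level_length_Suc:
  "level_length (Suc k) =
     (1 - (real (n (Suc k)) - 1) * c (Suc k)) / real (n (Suc k)) * level_length k"
  by (simp add: level_length_def)

lemma level_length_pos: "0 < level_length k"
proof (induction k)
  case (Suc k)
  then show ?case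
    using n_ge_2[of k] removed_less_1[of k] unfolding level_length_Suc
    by (intro mult_pos_pos divide_pos_pos) auto
qed (simp add: level_length_0)

lemma level_length_Suc_le: "real (n (Suc k)) * level_length (Suc k) \<le> level_length k"
proof -
  have "real (n (Suc k)) * level_length (Suc k) =
      (1 - (real (n (Suc k)) - 1) * c (Suc k)) * level_length k"
    using n_ge_2[of k] by (simp add: level_length_Suc)
  also have "\<dots> \<le> 1 * level_length k"
    using removed_pos[of k] level_length_pos[of k] by (intro mult_right_mono) auto
  finally show ?thesis by simp
qed

lemma level_length_le: "level_length k \<le> (1/2) ^ k"
proof (induction k)
  case (Suc k)
  have "2 * level_length (Suc k) \<le> real (n (Suc k)) * level_length (Suc k)"
    using n_ge_2[of k] level_length_pos[of "Suc k"] by (intro mult_right_mono) auto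
  then show ?case using level_length_Suc_le[of k] Suc by simp
qed (simp add: level_length_0)

lemma right_minus_left: "right w - left w = level_length (length w)"
proof (induction w rule: rev_induct)
  case Nil
  then show ?case by (simp add: word_ends_Nil level_length_0)
next
  case (snoc i w)
  interpret S: cantor_step "n (Suc (length w))" "c (Suc (length w))" "left w" "right w"
    by (rule word_step[OF params])
  show ?case
    using S.hi_eq[of i] snoc S.d_def
    by (simp add: word_ends_snoc level_length_Suc)
qed

lemma I_eq: "I w = {left w..right w}"
  by (simp add: word_interval_def)

lemma borel_I [measurable]: "I w \<in> sets borel"
  by (simp add: I_eq)

lemma borel_level [measurable]: "level k \<in> sets borel"
  unfolding cantor_level_def using finite_words by (intro sets.finite_UN) auto

lemma borel_E [measurable]: "E \<in> sets borel"
  unfolding uniform_cantor_set_def by (intro sets.countable_INT) auto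

lemma length_W: "w \<in> W k \<Longrightarrow> length w = k"
  by (simp add: words_def)

lemma W_snoc: "w \<in> W k \<Longrightarrow> i \<in> {1..n (Suc k)} \<Longrightarrow> w @ [i] \<in> W (Suc k)"
  unfolding words_Suc by force

lemma I_snoc_subset: "w \<in> W k \<Longrightarrow> i \<in> {1..n (Suc k)} \<Longrightarrow> I (w @ [i]) \<subseteq> I w"
  using word_interval_snoc_subset[OF params, of i w] by (simp add: length_W)

lemma level_Suc_subset: "level (Suc k) \<subseteq> level k"
  unfolding cantor_level_def words_Suc using I_snoc_subset by fastforce

lemma level_antimono: "decseq level"
  by (intro decseq_SucI level_Suc_subset)

lemma E_subset_level: "E \<subseteq> level k"
  by (auto simp: uniform_cantor_set_def)

lemma level_0: "level 0 = {0..1}"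
  by (simp add: cantor_level_def words_0 I_eq word_ends_Nil)

lemma disjoint_family_I: "disjoint_family_on I (W k)"
  unfolding disjoint_family_on_def using word_interval_disjoint[OF params] by blast

lemma disjoint_family_children:
  assumes "w \<in> W k"
  shows "disjoint_family_on (\<lambda>i. I (w @ [i])) {1..n (Suc k)}"
  unfolding disjoint_family_on_def
proof (intro ballI impI)
  fix i j assume "i \<in> {1..n (Suc k)}" "j \<in> {1..n (Suc k)}" "i \<noteq> j"
  then show "I (w @ [i]) \<inter> I (w @ [j]) = {}"
    using word_interval_disjoint[OF params W_snoc[OF assms] W_snoc[OF assms]] by simp
qed

lemma I_Int_eq_UN_children:
  assumes w: "w \<in> W k" and S: "S \<subseteq> level (Suc k)"
  shows "I w \<inter> S = (\<Union>i\<in>{1..n (Suc k)}. I (w @ [i]) \<inter> S)"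
proof (intro set_eqI iffI)
  fix x assume x: "x \<in> I w \<inter> S"
  then obtain v i where v: "v \<in> W k" "i \<in> {1..n (Suc k)}" "x \<in> I (v @ [i])"
    using S unfolding cantor_level_def words_Suc by auto
  then have "x \<in> I v \<inter> I w" using I_snoc_subset x by blast
  then have "v = w" using word_interval_disjoint[OF params v(1) w] by blast
  then show "x \<in> (\<Union>i\<in>{1..n (Suc k)}. I (w @ [i]) \<inter> S)" using v x by blast
next
  fix x assume "x \<in> (\<Union>i\<in>{1..n (Suc k)}. I (w @ [i]) \<inter> S)"
  then show "x \<in> I w \<inter> S" using I_snoc_subset[OF w] by blast
qed

lemma subset_level_eq_UN: "S \<subseteq> level k \<Longrightarrow> S = (\<Union>w\<in>W k. I w \<inter> S)"
  unfolding cantor_level_def by auto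

lemma measure_eq_sum_words:
  assumes "finite_measure M" "sets M = sets borel" "S \<in> sets borel" "S \<subseteq> level k"
  shows "measure M S = (\<Sum>w\<in>W k. measure M (I w \<inter> S))"
proof -
  interpret finite_measure M by fact
  have "measure M S = measure M (\<Union>w\<in>W k. I w \<inter> S)"
    using subset_level_eq_UN[OF assms(4)] by simp
  also have "\<dots> = (\<Sum>w\<in>W k. measure M (I w \<inter> S))"
    using assms disjoint_family_on_bisimulation[OF disjoint_family_I[of k], of "\<lambda>w. I w \<inter> S"]
    by (intro finite_measure_finite_Union finite_words) auto
  finally show ?thesis .
qed

lemma measure_eq_sum_children:
  assumes "finite_measure M" "sets M = sets borel" "S \<in> sets borel" "S \<subseteq> level (Suc k)"
    and "w \<in> W k"
  shows "measure M (I w \<inter> S) = (\<Sum>i\<in>{1..n (Suc k)}. measure M (I (w @ [i]) \<inter> S))"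
proof -
  interpret finite_measure M by fact
  show ?thesis unfolding I_Int_eq_UN_children[OF assms(5,4)]
    using assms
      disjoint_family_on_bisimulation[OF disjoint_family_children[OF assms(5)], of "\<lambda>i. I (w @ [i]) \<inter> S"]
    by (intro finite_measure_finite_Union) auto
qed

end

section \<open>Measures that are ultimately equidistributed\<close>

text \<open>
  The measures live on the whole line and vanish off \<open>E\<close>, so that the Cantor measure and restricted
  Lebesgue measure are objects of one kind and regularity of Borel measures applies to both. The
  total mass is arbitrary because Lebesgue measure on \<open>E\<close> need not be normalised.
\<close>

locale equidistributed_measure = uniform_cantor n c + finite_measure M
  for n :: "nat \<Rightarrow> nat" and c :: "nat \<Rightarrow> real" and M :: "real measure" +
  fixes K :: nat
  assumes sets_M [measurable_cong, simp]: "sets M = sets borel"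
    and measure_outside: "measure M (- E) = 0"
    and measure_child: "\<And>k w i. \<lbrakk>K \<le> k; w \<in> W k; i \<in> {1..n (Suc k)}\<rbrakk> \<Longrightarrow>
          measure M (I (w @ [i])) = measure M (I w) / real (n (Suc k))"
    and measure_I_pos: "\<And>w. w \<in> W K \<Longrightarrow> 0 < measure M (I w)"
begin

lemma measure_Int_E:
  assumes [measurable]: "A \<in> sets borel"
  shows "measure M (A \<inter> E) = measure M A"
proof -
  have "measure M A = measure M (A \<inter> E) + measure M (A - E)"
    using finite_measure_Diff'[of A E] by simp
  moreover have "measure M (A - E) \<le> measure M (- E)"
    by (rule finite_measure_mono) auto
  ultimately show ?thesis
    using measure_outside measure_nonneg[of M "A - E"] by linarith
qed

text \<open>
  Put \<open>N = n\<^bsub>k+1\<^esub>\<close>. If \<open>t N \<ge> 1\<close>, the window contains the last \<open>\<lfloor>t N\<rfloor>\<close> children, because \<open>q\<close> consecutive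
  children and the gaps between them take up at most the fraction \<open>q / N\<close> of the parent; rounding
  down costs the factor 2. If \<open>t N < 1\<close>, it contains the corresponding window of the last child with
  \<open>t N\<close> in place of \<open>t\<close>, and nothing is lost since that child has mass \<open>1 / N\<close> of the parent's.
  As \<open>N \<ge> 2\<close>, \<open>t\<close> at least doubles in the second case, so the recursion ends.
\<close>

lemma measure_right_end_ge:
  assumes "K \<le> k" "w \<in> W k" "0 < t" "t \<le> 1"
  shows "t / 2 * measure M (I w) \<le> measure M {right w - t * level_length k..right w}"
proof -
  obtain j where "(1/2) ^ j < t"
    using real_arch_pow_inv[of t "1/2"] assms(3) by auto
  then have "(1/2) ^ j \<le> t" by simp
  then show ?thesis using assms
  proof (induction j arbitrary: t w k)
    case 0
    then have "{right w - t * level_length k..right w} = I w"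
      using right_minus_left[of w] length_W[of w k] by (auto simp: I_eq)
    then show ?case using 0 by simp
  next
    case (Suc j)
    define N where "N = n (Suc k)"
    let ?L = "level_length k"
    have N: "2 \<le> N" using n_ge_2 by (simp add: N_def)
    have len: "length w = k" using Suc.prems length_W by simp
    interpret S: cantor_step N "c (Suc k)" "left w" "right w"
      using word_step[OF params, of w] by (simp add: N_def len)
    have L: "right w - left w = ?L" using right_minus_left[of w] len by simp
    have piece: "left (w @ [i]) = S.lo i" "right (w @ [i]) = S.hi i" for i
      by (simp_all add: word_ends_snoc N_def len)
    show ?case
    proof (cases "t * real N < 1")
      case True
      have "(1/2) ^ j \<le> 2 * t" using Suc.prems(1) by simp
      also have "\<dots> \<le> t * real N" using N Suc.prems by simp
      finally have "(1/2) ^ j \<le> t * real N" .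
      moreover have wN: "w @ [N] \<in> W (Suc k)"
        using Suc.prems N by (intro W_snoc) (auto simp: N_def)
      ultimately have "t * real N / 2 * measure M (I (w @ [N])) \<le>
          measure M {right (w @ [N]) - t * real N * level_length (Suc k)..right (w @ [N])}"
        using Suc.prems True N by (intro Suc.IH) auto
      also have "\<dots> \<le> measure M {right w - t * ?L..right w}"
      proof (rule finite_measure_mono)
        have "right (w @ [N]) = right w" using S.hi_N by (simp add: word_ends_snoc N_def len)
        moreover have "t * (real N * level_length (Suc k)) \<le> t * ?L"
          using Suc.prems level_length_Suc_le[of k] by (intro mult_left_mono) (auto simp: N_def)
        ultimately show "{right (w @ [N]) - t * real N * level_length (Suc k)..right (w @ [N])}
            \<subseteq> {right w - t * ?L..right w}" by (auto simp: mult.assoc)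
      qed simp
      finally show ?thesis
        using measure_child[of k w N] Suc.prems N by (simp add: N_def)
    next
      case False
      define q where "q = nat \<lfloor>t * real N\<rfloor>"
      have q: "1 \<le> q" "real q \<le> t * real N" "t * real N < real q + 1"
        using False unfolding q_def by linarith+
      have "real q \<le> 1 * real N"
        using q(2) Suc.prems N by (meson mult_right_mono of_nat_0_le_iff order_trans)
      then have "q \<le> N" by simp
      have "right w - t * ?L \<le> left (w @ [i])" if "i \<in> {N - q<..N}" for i
      proof -
        \<comment> \<open>\<open>N\<close> children with \<open>N\<close> gaps exceed the parent by one gap, so a child together with one gap
          takes at least \<open>1 / N\<close> of the parent.\<close>
        have "real N * (S.d + c (Suc k) * ?L) = ?L + c (Suc k) * ?L"
          using N by (simp add: S.d_def L field_simps)
        moreover have "0 \<le> c (Suc k) * ?L"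
          using c_pos[of k] level_length_pos[of k] by simp
        ultimately have "?L / real N \<le> S.d + c (Suc k) * ?L"
          using N by (simp add: field_simps)
        then have "(real N - real q) * (?L / real N) \<le> (real i - 1) * (S.d + c (Suc k) * ?L)"
          using that \<open>q \<le> N\<close> level_length_pos[of k] by (intro mult_mono) auto
        moreover have "(real N - real q) * (?L / real N) \<ge> ?L - t * ?L"
        proof -
          have "real q / real N * ?L \<le> t * ?L"
            using q(2) N level_length_pos[of k] by (intro mult_right_mono) (auto simp: field_simps)
          then show ?thesis using N by (simp add: field_simps)
        qed
        ultimately show ?thesis using S.lo_eq[of i, unfolded L] L unfolding piece by linarith
      qed
      moreover have "right (w @ [i]) \<le> right w" if "i \<in> {N - q<..N}" for i
        using S.subset[of i] that S.lo_less_hi[of i] by (auto simp: piece)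
      ultimately have sub: "(\<Union>i\<in>{N - q<..N}. I (w @ [i])) \<subseteq> {right w - t * ?L..right w}"
        by (fastforce simp: I_eq)
      have ch: "i \<in> {1..n (Suc k)}" if "i \<in> {N - q<..N}" for i
        using that by (auto simp: N_def)
      have "t / 2 * measure M (I w) \<le> real q / real N * measure M (I w)"
        using q N by (intro mult_right_mono) (auto simp: field_simps)
      also have "\<dots> = (\<Sum>i\<in>{N - q<..N}. measure M (I w) / real N)"
        using \<open>q \<le> N\<close> by simp
      also have "\<dots> = (\<Sum>i\<in>{N - q<..N}. measure M (I (w @ [i])))"
        using measure_child[OF Suc.prems(2,3)] ch by (intro sum.cong) (auto simp: N_def)
      also have "\<dots> = measure M (\<Union>i\<in>{N - q<..N}. I (w @ [i]))"
      proof (rule finite_measure_finite_Union[symmetric])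
        show "disjoint_family_on (\<lambda>i. I (w @ [i])) {N - q<..N}"
          by (rule disjoint_family_on_mono[OF _ disjoint_family_children[OF Suc.prems(3)]])
            (use ch in blast)
      qed auto
      also have "\<dots> \<le> measure M {right w - t * ?L..right w}"
        using sub by (rule finite_measure_mono) simp
      finally show ?thesis .
    qed
  qed
qed

lemma measure_UN_words:
  assumes "V \<subseteq> W k"
  shows "measure M (\<Union>w\<in>V. I w \<inter> E) = (\<Sum>w\<in>V. measure M (I w))"
proof -
  have "measure M (\<Union>w\<in>V. I w \<inter> E) = (\<Sum>w\<in>V. measure M (I w \<inter> E))"
  proof (rule finite_measure_finite_Union)
    show "finite V" using assms finite_words finite_subset by blast
    show "disjoint_family_on (\<lambda>w. I w \<inter> E) V"
      using disjoint_family_on_mono[OF assms disjoint_family_I]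
      by (rule disjoint_family_on_bisimulation) auto
  qed auto
  also have "\<dots> = (\<Sum>w\<in>V. measure M (I w))" by (simp add: measure_Int_E)
  finally show ?thesis .
qed

end

context uniform_cantor
begin

text \<open>
  For open \<open>U\<close>, these sets increase to \<open>U \<inter> E\<close>, because the lengths of the components tend to 0;
  each is a finite disjoint union to which bounds for single components apply.
\<close>

definition inner_cover :: "real set \<Rightarrow> nat \<Rightarrow> real set" where
  "inner_cover U k = (\<Union>w\<in>{w\<in>W k. I w \<subseteq> U}. I w \<inter> E)"

lemma borel_inner_cover [measurable]: "inner_cover U k \<in> sets borel"
  unfolding inner_cover_def by (intro sets.finite_UN) (auto simp: finite_words)

lemma inner_cover_mono: "inner_cover U k \<subseteq> inner_cover U (Suc k)"
proof
  fix x assume "x \<in> inner_cover U k"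
  then obtain w where w: "w \<in> W k" "I w \<subseteq> U" "x \<in> I w \<inter> E"
    by (auto simp: inner_cover_def)
  then obtain i where i: "i \<in> {1..n (Suc k)}" "x \<in> I (w @ [i]) \<inter> E"
    using I_Int_eq_UN_children[OF w(1) E_subset_level] by blast
  then show "x \<in> inner_cover U (Suc k)"
    using W_snoc[OF w(1) i(1)] I_snoc_subset[OF w(1) i(1)] w(2)
    unfolding inner_cover_def by blast
qed

lemma UN_inner_cover:
  assumes "open U"
  shows "(\<Union>k. inner_cover U (k + K)) = U \<inter> E"
proof
  show "(\<Union>k. inner_cover U (k + K)) \<subseteq> U \<inter> E" by (auto simp: inner_cover_def)
  show "U \<inter> E \<subseteq> (\<Union>k. inner_cover U (k + K))"
  proof
    fix x assume x: "x \<in> U \<inter> E"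
    then obtain e where e: "0 < e" "ball x e \<subseteq> U" using assms open_contains_ball by blast
    obtain k where k: "(1/2) ^ k < e" using real_arch_pow_inv[of e "1/2"] e by auto
    have "level_length (k + K) \<le> (1/2) ^ (k + K)" by (rule level_length_le)
    also have "\<dots> \<le> (1/2) ^ k" by (rule power_decreasing) auto
    finally have small: "level_length (k + K) < e" using k by simp
    obtain w where w: "w \<in> W (k + K)" "x \<in> I w"
      using x E_subset_level[of "k + K"] by (auto simp: cantor_level_def)
    have "I w \<subseteq> ball x e"
      using w small right_minus_left[of w] length_W[OF w(1)]
      by (auto simp: I_eq dist_real_def)
    then show "x \<in> (\<Union>k. inner_cover U (k + K))"
      using w x e unfolding inner_cover_def by blast
  qed
qed

text \<open>
  From level \<open>K\<close> on both measures are divided in the same proportions, so the quotient of the masses of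
  a component is inherited by its descendants and takes only finitely many values. A constant that works for
  components of one level works for their disjoint unions, and passes to limits.
\<close>

lemma equidistributed_measures_comparable:
  assumes M: "equidistributed_measure n c M K" and M': "equidistributed_measure n c M' K"
  obtains a where "0 \<le> a" "\<And>A. A \<in> sets borel \<Longrightarrow> measure M A \<le> a * measure M' A"
proof -
  interpret M: equidistributed_measure n c M K by fact
  interpret M': equidistributed_measure n c M' K by fact
  \<comment> \<open>The sum is a convenient upper bound of the finitely many quotients.\<close>
  define a where "a = (\<Sum>w\<in>W K. measure M (I w) / measure M' (I w))"
  have "0 \<le> a" unfolding a_def by (intro sum_nonneg) auto
  have word: "measure M (I w) \<le> a * measure M' (I w)" if "K \<le> k" "w \<in> W k" for k w
    using that
  proof (induction k arbitrary: w rule: nat_induct_at_least)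
    case base
    have "measure M (I w) / measure M' (I w) \<le> a"
      unfolding a_def using base finite_words by (intro member_le_sum) auto
    then show ?case using M'.measure_I_pos[OF base] by (simp add: field_simps)
  next
    case (Suc k)
    then obtain v i where v: "w = v @ [i]" "v \<in> W k" "i \<in> {1..n (Suc k)}"
      unfolding words_Suc by auto
    then show ?case
      using Suc.IH[OF v(2)] M.measure_child[OF Suc.hyps v(2,3)] M'.measure_child[OF Suc.hyps v(2,3)]
      by (simp add: divide_right_mono)
  qed
  have opens: "measure M U \<le> a * measure M' U" if "open U" for U
  proof -
    have [measurable]: "U \<in> sets borel" using that by simp
    have inc: "incseq (\<lambda>k. inner_cover U (k + K))"
      using inner_cover_mono by (intro incseq_SucI) simp
    have "(\<lambda>k. measure M (inner_cover U (k + K))) \<longlonglongrightarrow> measure M (\<Union>k. inner_cover U (k + K))"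
      by (rule M.finite_Lim_measure_incseq) (use inc in auto)
    moreover have "(\<lambda>k. measure M' (inner_cover U (k + K))) \<longlonglongrightarrow> measure M' (\<Union>k. inner_cover U (k + K))"
      by (rule M'.finite_Lim_measure_incseq) (use inc in auto)
    moreover have "measure M (inner_cover U (k + K)) \<le> a * measure M' (inner_cover U (k + K))" for k
    proof -
      have "{w \<in> W (k + K). I w \<subseteq> U} \<subseteq> W (k + K)" by auto
      from M.measure_UN_words[OF this] M'.measure_UN_words[OF this] show ?thesis
        unfolding inner_cover_def sum_distrib_left
        by (simp add: sum_distrib_left) (intro sum_mono word[of "k + K"], auto)
    qed
    ultimately have "measure M (U \<inter> E) \<le> a * measure M' (U \<inter> E)"
      unfolding UN_inner_cover[OF that]
      by (intro LIMSEQ_le[OF _ tendsto_mult_left]) auto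
    then show ?thesis by (simp add: M.measure_Int_E M'.measure_Int_E)
  qed
  have "measure M A \<le> a * measure M' A" if A: "A \<in> sets borel" for A
  proof (rule field_le_epsilon)
    fix e :: real assume "0 < e"
    define \<delta> where "\<delta> = e / (a + 1)"
    have \<delta>: "0 < \<delta>" "a * \<delta> \<le> e" using \<open>0 < e\<close> \<open>0 \<le> a\<close> by (auto simp: \<delta>_def field_simps)
    have "(INF U\<in>{U. A \<subseteq> U \<and> open U}. emeasure M' U) = emeasure M' A"
      using outer_regular[of M' A] A by simp
    also have "\<dots> < emeasure M' A + ennreal \<delta>"
      using \<delta> by (simp add: M'.emeasure_eq_measure ennreal_less_iff flip: ennreal_plus)
    finally obtain U where U: "A \<subseteq> U" "open U" "emeasure M' U < emeasure M' A + ennreal \<delta>"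
      unfolding INF_less_iff by auto
    then have "measure M' U < measure M' A + \<delta>"
      using \<delta> by (simp add: M'.emeasure_eq_measure ennreal_less_iff flip: ennreal_plus)
    have "measure M A \<le> measure M U" using U by (intro M.finite_measure_mono) auto
    also have "\<dots> \<le> a * measure M' U" by (rule opens) fact
    also have "\<dots> \<le> a * (measure M' A + \<delta>)"
      using \<open>0 \<le> a\<close> \<open>measure M' U < _\<close> by (intro mult_left_mono) auto
    finally show "measure M A \<le> a * measure M' A + e" using \<delta> by (simp add: algebra_simps)
  qed
  then show thesis using that \<open>0 \<le> a\<close> by blast
qed

end

section \<open>Necessity: the gaps of a doubling extension\<close>

lemma doubling_measure_on_finite_realE:
  assumes "doubling_measure_on {0..1::real} \<nu>"
  obtains C where "1 \<le> C" "finite_measure \<nu>"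
    "\<And>x r. \<lbrakk>x \<in> {0..1}; 0 < r\<rbrakk> \<Longrightarrow>
       measure \<nu> (ball x (2 * r) \<inter> {0..1}) \<le> C * measure \<nu> (ball x r \<inter> {0..1})"
proof -
  from assms obtain C :: real where sets: "sets \<nu> = sets (restrict_space borel {0..1})"
    and C: "1 \<le> C" "\<And>x r. x \<in> {0..1} \<Longrightarrow> 0 < r \<Longrightarrow>
        emeasure \<nu> (ball x (2 * r) \<inter> {0..1}) \<le> ennreal C * emeasure \<nu> (ball x r \<inter> {0..1}) \<and>
        ennreal C * emeasure \<nu> (ball x r \<inter> {0..1}) < \<infinity>"
    unfolding doubling_measure_on_def by blast
  have "space \<nu> = {0..1}"
    using sets_eq_imp_space_eq[OF sets] by (simp add: space_restrict_space)
  moreover have "ball 0 (2 * 1) \<inter> {0..1} = {0..1::real}" by (auto simp: dist_real_def)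
  ultimately have "emeasure \<nu> (space \<nu>) < \<infinity>"
    using C(2)[of 0 1] by (metis atLeastAtMost_iff le_less_trans order_refl zero_le_one zero_less_one)
  then interpret finite_measure \<nu> by (intro finite_measureI) auto
  have "measure \<nu> (ball x (2 * r) \<inter> {0..1}) \<le> C * measure \<nu> (ball x r \<inter> {0..1})"
    if "x \<in> {0..1}" "0 < r" for x r
    using C(2)[OF that] \<open>1 \<le> C\<close>
    by (simp add: emeasure_eq_measure flip: ennreal_mult)
  then show thesis using that C(1) finite_measure_axioms by blast
qed

context equidistributed_measure
begin

lemma sum_words_eq_total: "(\<Sum>w\<in>W k. measure M (I w)) = measure M UNIV"
proof -
  have "(\<Union>w\<in>W k. I w \<inter> E) = E"
    using E_subset_level[of k] unfolding cantor_level_def by auto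
  then show ?thesis
    using measure_UN_words[of "W k" k] measure_Int_E[of UNIV] by simp
qed

text \<open>
  The gap is the ball of radius \<open>g / 2\<close> about its midpoint, where \<open>g\<close> is its length. The ball of radius
  \<open>g\<close> contains the last piece of length at most \<open>g / 4\<close> of the child on the left. Since that child is no longer
  than \<open>1 / n\<^bsub>k+1\<^esub>\<close> of \<open>I\<^sub>w\<close>, the fraction \<open>t = n\<^bsub>k+1\<^esub> c\<^bsub>k+1\<^esub> / 4\<close> of it is such a piece; its mass is at least
  \<open>t / 2\<close> times that of the child, and \<open>n\<^bsub>k+1\<^esub>\<close> cancels.
\<close>

lemma gap_measure_ge:
  assumes sets_\<nu>: "sets \<nu> = sets (restrict_space borel {0..1})"
    and fin: "finite_measure \<nu>"
    and doubling: "\<And>x r. \<lbrakk>x \<in> {0..1}; 0 < r\<rbrakk> \<Longrightarrow>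
       measure \<nu> (ball x (2 * r) \<inter> {0..1}) \<le> C * measure \<nu> (ball x r \<inter> {0..1})"
    and ext: "\<And>A. A \<in> sets borel \<Longrightarrow> measure \<nu> (A \<inter> E) = measure M A"
    and k: "K \<le> k" "w \<in> W k" and i: "i \<in> {1..<n (Suc k)}"
  shows "c (Suc k) / 8 * measure M (I w)
       \<le> C * measure \<nu> {right (w @ [i])<..<left (w @ [Suc i])}"
proof -
  interpret \<nu>: finite_measure \<nu> by fact
  define N where "N = n (Suc k)"
  define L where "L = level_length k"
  define x where "x = right (w @ [i])"
  define g where "g = c (Suc k) * L"
  define t where "t = real N * c (Suc k) / 4"
  have len: "length w = k" using k length_W by simp
  have N: "2 \<le> N" using n_ge_2 by (simp add: N_def)
  interpret S: cantor_step N "c (Suc k)" "left w" "right w"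
    using word_step[OF params, of w] by (simp add: N_def len)
  have piece: "left (w @ [i]) = S.lo i" "right (w @ [i]) = S.hi i" for i
    by (simp_all add: word_ends_snoc N_def len)
  have L: "right w - left w = L" using right_minus_left[of w] len by (simp add: L_def)
  have "0 < L" using level_length_pos by (simp add: L_def)
  have "0 < g" using c_pos[of k] \<open>0 < L\<close> by (simp add: g_def)
  have gap: "left (w @ [Suc i]) = x + g"
    using S.gap_length[of i] L by (simp add: piece x_def g_def del: prod.collapse)
  have wi: "w @ [i] \<in> W (Suc k)" "w @ [Suc i] \<in> W (Suc k)"
    using i by (auto intro!: W_snoc k)
  have sub01: "I v \<subseteq> {0..1}" if "v \<in> W j" for v j
    using that level_antimono[THEN decseqD, of 0 j] level_0 unfolding cantor_level_def by blast
  have "x \<in> I (w @ [i])" "x + g \<in> I (w @ [Suc i])"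
    using word_ends_less[OF params, of "w @ [i]"] word_ends_less[OF params, of "w @ [Suc i]"] gap
    by (auto simp: I_eq x_def less_imp_le)
  then have x01: "x \<in> {0..1}" "x + g \<in> {0..1}" using sub01 wi by blast+
  have t: "0 < t" "t \<le> 1"
  proof -
    show "0 < t" using c_pos[of k] N by (simp add: t_def)
    \<comment> \<open>\<open>N \<le> 2 (N - 1)\<close> and \<open>(N - 1) c\<^bsub>k+1\<^esub> < 1\<close> even give \<open>t < 1 / 2\<close>.\<close>
    have "real N * c (Suc k) \<le> 2 * ((real N - 1) * c (Suc k))"
      using N c_pos[of k] by (simp add: field_simps)
    also have "\<dots> < 2 * 1" using removed_less_1[of k] by (simp add: N_def)
    finally show "t \<le> 1" by (simp add: t_def)
  qed
  have small: "t * level_length (Suc k) \<le> g / 4"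
  proof -
    have "t * level_length (Suc k) = c (Suc k) / 4 * (real N * level_length (Suc k))"
      by (simp add: t_def)
    also have "\<dots> \<le> c (Suc k) / 4 * L"
      using level_length_Suc_le[of k] c_pos[of k]
      by (intro mult_left_mono) (auto simp: N_def L_def)
    finally show ?thesis by (simp add: g_def)
  qed
  have "c (Suc k) / 8 * measure M (I w) = t / 2 * measure M (I (w @ [i]))"
    using measure_child[OF k, of i] i N by (simp add: t_def N_def)
  also have "\<dots> \<le> measure M {x - t * level_length (Suc k)..x}"
    using measure_right_end_ge[OF _ wi(1) t] k by (simp add: x_def)
  also have "\<dots> = measure \<nu> ({x - t * level_length (Suc k)..x} \<inter> E)"
    by (simp add: ext)
  also have "\<dots> \<le> measure \<nu> (ball (x + g / 2) (2 * (g / 2)) \<inter> {0..1})"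
  proof (rule \<nu>.finite_measure_mono)
    show "{x - t * level_length (Suc k)..x} \<inter> E \<subseteq> ball (x + g / 2) (2 * (g / 2)) \<inter> {0..1}"
      using small \<open>0 < g\<close> E_subset_level[of 0] level_0 by (auto simp: dist_real_def)
    show "ball (x + g / 2) (2 * (g / 2)) \<inter> {0..1} \<in> sets \<nu>"
      unfolding sets_\<nu> by (subst sets_restrict_space_iff) auto
  qed
  also have "\<dots> \<le> C * measure \<nu> (ball (x + g / 2) (g / 2) \<inter> {0..1})"
    using x01 \<open>0 < g\<close> by (intro doubling) auto
  also have "ball (x + g / 2) (g / 2) \<inter> {0..1} = {x<..<left (w @ [Suc i])}"
    using x01 by (auto simp: ball_eq_greaterThanLessThan gap)
  finally show ?thesis by (simp add: x_def)
qed

text \<open>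
  The gaps of level \<open>k + 1\<close> are disjoint subsets of \<open>E\<^sub>k - E\<^bsub>k+1\<^esub>\<close>, with \<open>n\<^bsub>k+1\<^esub> - 1 \<ge> n\<^bsub>k+1\<^esub> / 2\<close> of them
  in every component. Adding up the lower bounds over the components recovers the total mass 1,
  so \<open>E\<^sub>k - E\<^bsub>k+1\<^esub>\<close> has at least \<open>n\<^bsub>k+1\<^esub> c\<^bsub>k+1\<^esub> / (16 C)\<close>.
\<close>

lemma summable_if_doubling_extension:
  assumes \<nu>: "doubling_measure_on {0..1} \<nu>"
    and ext: "\<And>A. A \<in> sets borel \<Longrightarrow> measure \<nu> (A \<inter> E) = measure M A"
    and total: "measure M UNIV = 1"
  shows "summable (\<lambda>k. real (n (Suc k)) * c (Suc k))"
proof -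
  have sets_\<nu>: "sets \<nu> = sets (restrict_space borel {0..1})"
    using \<nu> by (simp add: doubling_measure_on_def)
  obtain C where C: "1 \<le> C" and fin: "finite_measure \<nu>"
    and doubling: "\<And>x r. \<lbrakk>x \<in> {0..1}; 0 < r\<rbrakk> \<Longrightarrow>
       measure \<nu> (ball x (2 * r) \<inter> {0..1}) \<le> C * measure \<nu> (ball x r \<inter> {0..1})"
    using doubling_measure_on_finite_realE[OF \<nu>] by blast
  interpret \<nu>: finite_measure \<nu> by fact
  have level_01: "level k \<subseteq> {0..1}" for k
    using level_antimono[THEN decseqD, of 0 k] level_0 by simp
  have in_\<nu>: "A \<in> sets \<nu>" if "A \<in> sets borel" "A \<subseteq> {0..1}" for A
    unfolding sets_\<nu> using that by (subst sets_restrict_space_iff) auto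
  have step: "real (n (Suc k)) * c (Suc k)
      \<le> 16 * C * (measure \<nu> (level k) - measure \<nu> (level (Suc k)))" if k: "K \<le> k" for k
  proof -
    define N where "N = n (Suc k)"
    have N: "2 \<le> N" using n_ge_2 by (simp add: N_def)
    define gap where "gap = (\<lambda>(w, i). {right (w @ [i])<..<left (w @ [Suc i])})"
    define J where "J = W k \<times> {1..<N}"
    have step: "cantor_step N (c (Suc k)) (left w) (right w)" if "w \<in> W k" for w
      using word_step[OF params, of w] length_W[OF that] by (simp add: N_def)
    have ends: "word_ends n c (w @ [i]) = sub_interval N (c (Suc k)) (left w, right w) i"
      if "w \<in> W k" for w i
      using length_W[OF that] by (simp add: word_ends_snoc N_def)
    have gap_sub: "gap (w, i) \<subseteq> I w - (\<Union>i\<in>{1..N}. I (w @ [i]))" if "(w, i) \<in> J" for w i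
    proof -
      have w: "w \<in> W k" "i \<in> {1..<N}" using that by (auto simp: J_def)
      have "gap (w, i) \<subseteq> (\<Union>i\<in>{1..<N}. gap (w, i))" using w by blast
      also have "\<dots> = I w - (\<Union>i\<in>{1..N}. I (w @ [i]))"
        unfolding gap_def I_eq ends[OF w(1)] prod.case using cantor_step.deleted[OF step[OF w(1)]] ..
      finally show ?thesis .
    qed
    have UN_gap: "(\<Union>p\<in>J. gap p) \<subseteq> level k - level (Suc k)"
    proof (clarify)
      fix w i x assume J: "(w, i) \<in> J" and x: "x \<in> gap (w, i)"
      then have w: "w \<in> W k" by (simp add: J_def)
      have "x \<in> I w" "x \<notin> (\<Union>i\<in>{1..N}. I (w @ [i]))" using gap_sub[OF J] x by blast+
      moreover have "I w \<inter> level (Suc k) = (\<Union>i\<in>{1..n (Suc k)}. I (w @ [i]) \<inter> level (Suc k))"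
        by (rule I_Int_eq_UN_children[OF w order_refl])
      ultimately show "x \<in> level k - level (Suc k)"
        using w unfolding N_def cantor_level_def by blast
    qed
    have same: "gap (w, i) \<inter> gap (w, j) = {}" if "w \<in> W k" "i < j" for w i j
    proof -
      interpret S: cantor_step N "c (Suc k)" "left w" "right w" by (rule step[OF that(1)])
      have "left (w @ [Suc i]) \<le> left (w @ [j])"
        unfolding ends[OF that(1)] using that(2) by (intro S.lo_mono) simp
      also have "\<dots> < right (w @ [j])" by (rule word_ends_less[OF params])
      finally show ?thesis by (auto simp: gap_def)
    qed
    have "disjoint_family_on gap J"
      unfolding disjoint_family_on_def
    proof (intro ballI impI)
      fix p q assume pq: "p \<in> J" "q \<in> J" "p \<noteq> q"
      obtain w i v j where eq: "p = (w, i)" "q = (v, j)" by (cases p, cases q) auto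
      have wv: "w \<in> W k" "v \<in> W k" using pq eq by (auto simp: J_def)
      show "gap p \<inter> gap q = {}"
      proof (cases "w = v")
        case True
        then show ?thesis
          using same[OF wv(1), of i j] same[OF wv(1), of j i] pq(3) eq
          by (cases i j rule: linorder_cases) auto
      next
        case False
        then show ?thesis
          using word_interval_disjoint[OF params wv] gap_sub pq(1,2) unfolding eq by blast
      qed
    qed
    moreover have "finite J" by (simp add: J_def finite_words)
    moreover have "gap ` J \<subseteq> sets \<nu>"
    proof
      fix A assume "A \<in> gap ` J"
      then have "A \<subseteq> level k" "A \<in> sets borel"
        using UN_gap by (auto simp: gap_def)
      then show "A \<in> sets \<nu>" using level_01[of k] by (intro in_\<nu>) auto
    qed
    ultimately have sum_gaps: "measure \<nu> (\<Union>p\<in>J. gap p) = (\<Sum>p\<in>J. measure \<nu> (gap p))"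
      by (intro \<nu>.finite_measure_finite_Union)
    have "real N * c (Suc k) / 16 \<le> (real N - 1) * c (Suc k) / 8"
      using N c_pos[of k] by (simp add: field_simps)
    also have "\<dots> = (real N - 1) * c (Suc k) / 8 * (\<Sum>w\<in>W k. measure M (I w))"
      by (simp add: sum_words_eq_total total)
    also have "\<dots> = (\<Sum>w\<in>W k. \<Sum>i\<in>{1..<N}. c (Suc k) / 8 * measure M (I w))"
      unfolding sum_distrib_left using N by (intro sum.cong) (auto simp: of_nat_diff)
    also have "\<dots> = (\<Sum>(w, i)\<in>J. c (Suc k) / 8 * measure M (I w))"
      unfolding J_def by (rule sum.cartesian_product)
    also have "\<dots> \<le> (\<Sum>(w, i)\<in>J. C * measure \<nu> (gap (w, i)))"
    proof (rule sum_mono, clarify)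
      fix w i assume "(w, i) \<in> J"
      then show "c (Suc k) / 8 * measure M (I w) \<le> C * measure \<nu> (gap (w, i))"
        unfolding gap_def prod.case using k
        by (intro gap_measure_ge[OF sets_\<nu> fin doubling ext]) (auto simp: J_def N_def)
    qed
    also have "\<dots> = C * measure \<nu> (\<Union>p\<in>J. gap p)"
      unfolding sum_gaps by (simp add: sum_distrib_left case_prod_unfold)
    also have "\<dots> \<le> C * measure \<nu> (level k - level (Suc k))"
      using UN_gap C level_01[of k]
      by (intro mult_left_mono \<nu>.finite_measure_mono in_\<nu>) auto
    also have "measure \<nu> (level k - level (Suc k)) = measure \<nu> (level k) - measure \<nu> (level (Suc k))"
      using level_Suc_subset[of k] level_01 by (intro \<nu>.finite_measure_Diff in_\<nu>) auto
    finally show ?thesis by (simp add: N_def)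
  qed
  have "(\<lambda>k. measure \<nu> (level k)) \<longlonglongrightarrow> measure \<nu> (\<Inter>k. level k)"
    using level_antimono level_01 by (intro \<nu>.finite_Lim_measure_decseq) (auto intro!: in_\<nu>)
  then have "summable (\<lambda>k. 16 * C * (measure \<nu> (level k) - measure \<nu> (level (Suc k))))"
    by (intro summable_mult telescope_summable')
  then show ?thesis
  proof (rule summable_comparison_test'[where N = K])
    fix k assume "K \<le> k"
    then show "norm (real (n (Suc k)) * c (Suc k))
        \<le> 16 * C * (measure \<nu> (level k) - measure \<nu> (level (Suc k)))"
      using step[of k] c_pos[of k] by simp
  qed
qed

end

section \<open>Sufficiency: gluing with Lebesgue measure\<close>

lemma ex_sum_measure:
  assumes N: "sets N = sets M"
  shows "\<exists>L. sets L = sets M \<and> (\<forall>A\<in>sets M. emeasure L A = emeasure M A + emeasure N A)"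
proof (intro exI conjI ballI)
  let ?L = "measure_of (space M) (sets M) (\<lambda>A. emeasure M A + emeasure N A)"
  show "sets ?L = sets M" by (rule sets.sets_measure_of_eq)
  fix A assume A: "A \<in> sets M"
  show "emeasure ?L A = emeasure M A + emeasure N A"
  proof (rule emeasure_measure_of_sigma)
    show "countably_additive (sets M) (\<lambda>A. emeasure M A + emeasure N A)"
      unfolding countably_additive_def
    proof (intro allI impI)
      fix F :: "nat \<Rightarrow> 'a set"
      assume F: "range F \<subseteq> sets M" "disjoint_family F"
      then have "(\<Sum>i. emeasure M (F i)) = emeasure M (\<Union>i. F i)"
        "(\<Sum>i. emeasure N (F i)) = emeasure N (\<Union>i. F i)"
        using N by (auto intro!: suminf_emeasure)
      then show "(\<Sum>i. emeasure M (F i) + emeasure N (F i)) =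
          emeasure M (\<Union>i. F i) + emeasure N (\<Union>i. F i)"
        by (simp add: suminf_add[symmetric])
    qed
  qed (use A sets.sigma_algebra_axioms in \<open>auto simp: positive_def\<close>)
qed

definition unit_lebesgue :: "real measure" where
  "unit_lebesgue = density lborel (indicator {0..1})"

lemma sets_unit_lebesgue [measurable_cong, simp]: "sets unit_lebesgue = sets borel"
  by (simp add: unit_lebesgue_def)

lemma space_unit_lebesgue [simp]: "space unit_lebesgue = UNIV"
  by (simp add: unit_lebesgue_def)

lemma emeasure_unit_lebesgue:
  "A \<in> sets borel \<Longrightarrow> emeasure unit_lebesgue A = emeasure lborel ({0..1} \<inter> A)"
  unfolding unit_lebesgue_def by (subst emeasure_restricted) auto

lemma measure_unit_lebesgue:
  "A \<in> sets borel \<Longrightarrow> measure unit_lebesgue A = measure lborel ({0..1} \<inter> A)"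
  by (simp add: measure_def emeasure_unit_lebesgue)

lemma finite_measure_unit_lebesgue: "finite_measure unit_lebesgue"
  by (rule finite_measureI) (simp add: unit_lebesgue_def emeasure_restricted)

text \<open>
  Lebesgue measure on the unit interval is doubling: a ball of radius \<open>r\<close> contains an interval of
  length \<open>min r (1/2)\<close> on the side of its centre where there is room, and the ball of twice the radius
  has measure at most \<open>min 1 (4 r)\<close>. Two-sided bounds transfer this to \<open>\<nu>\<close>.
\<close>

lemma doubling_measure_if_comparable_to_lebesgue:
  assumes sets_\<nu>: "sets \<nu> = sets (restrict_space borel {0..1::real})"
    and fin: "finite_measure \<nu>"
    and low: "\<And>A. \<lbrakk>A \<in> sets borel; A \<subseteq> {0..1}\<rbrakk> \<Longrightarrow> measure unit_lebesgue A \<le> \<alpha> * measure \<nu> A"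
    and upp: "\<And>A. \<lbrakk>A \<in> sets borel; A \<subseteq> {0..1}\<rbrakk> \<Longrightarrow> measure \<nu> A \<le> \<beta> * measure unit_lebesgue A"
    and pos: "1 \<le> \<alpha>" "1 \<le> \<beta>"
  shows "doubling_measure_on {0..1} \<nu>"
proof -
  interpret \<nu>: finite_measure \<nu> by fact
  interpret U: finite_measure unit_lebesgue by (rule finite_measure_unit_lebesgue)
  let ?B = "\<lambda>x r. ball x r \<inter> {0..1::real}"
  have below: "min r (1/2) \<le> measure unit_lebesgue (?B x r)" if x: "x \<in> {0..1}" and "0 < r" for x r
  proof -
    define s where "s = min r (1/2)"
    define a where "a = (if x \<le> 1/2 then x else x - s)"
    have s: "0 < s" "s \<le> r" "s \<le> 1/2" using \<open>0 < r\<close> by (auto simp: s_def)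
    have sub: "{a<..<a + s} \<subseteq> ?B x r"
      using s x by (auto simp: a_def dist_real_def split: if_splits)
    have "s = measure unit_lebesgue {a<..<a + s}"
    proof -
      have "{0..1} \<inter> {a<..<a + s} = {a<..<a + s}" using sub by auto
      then show ?thesis using s by (simp add: measure_unit_lebesgue)
    qed
    also have "\<dots> \<le> measure unit_lebesgue (?B x r)"
      using sub by (intro U.finite_measure_mono) auto
    finally show ?thesis by (simp add: s_def)
  qed
  have above: "measure unit_lebesgue (?B x (2 * r)) \<le> 8 * min r (1/2)" if "0 < r" for x r
  proof -
    have "measure unit_lebesgue (?B x (2 * r)) \<le> measure unit_lebesgue {0..1}"
      by (intro U.finite_measure_mono) auto
    then have "measure unit_lebesgue (?B x (2 * r)) \<le> 1" by (simp add: measure_unit_lebesgue)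
    moreover have "measure unit_lebesgue (?B x (2 * r)) \<le> 4 * r"
    proof -
      have "measure unit_lebesgue (?B x (2 * r)) = measure lborel (?B x (2 * r))"
        by (subst measure_unit_lebesgue) (auto intro!: arg_cong[where f = "measure lborel"])
      also have "\<dots> \<le> measure lborel {x - 2 * r..x + 2 * r}"
        using that by (intro measure_mono_fmeasurable)
          (auto simp: dist_real_def fmeasurable_def)
      finally show ?thesis using that by simp
    qed
    ultimately show ?thesis using that by (auto simp: min_def)
  qed
  define C where "C = 8 * \<alpha> * \<beta>"
  have C: "1 \<le> C" using mult_mono[of 1 \<alpha> 1 \<beta>] pos by (simp add: C_def)
  have pos_ball: "0 < measure \<nu> (?B x r)" if "x \<in> {0..1}" "0 < r" for x r
  proof -
    have "0 < min r (1/2)" using that by simp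
    also have "\<dots> \<le> measure unit_lebesgue (?B x r)" using below[OF that] .
    also have "\<dots> \<le> \<alpha> * measure \<nu> (?B x r)" by (intro low) auto
    finally show ?thesis using pos by (simp add: zero_less_mult_iff)
  qed
  have doubling: "measure \<nu> (?B x (2 * r)) \<le> C * measure \<nu> (?B x r)"
    if "x \<in> {0..1}" "0 < r" for x r
  proof -
    have "measure \<nu> (?B x (2 * r)) \<le> \<beta> * measure unit_lebesgue (?B x (2 * r))" by (intro upp) auto
    also have "\<dots> \<le> \<beta> * (8 * min r (1/2))" using above[OF that(2)] pos by (intro mult_left_mono) auto
    also have "\<dots> \<le> \<beta> * (8 * measure unit_lebesgue (?B x r))"
      using below[OF that] pos by (intro mult_left_mono) auto
    also have "\<dots> \<le> \<beta> * (8 * (\<alpha> * measure \<nu> (?B x r)))"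
      using pos by (intro mult_left_mono low) auto
    finally show ?thesis by (simp add: C_def algebra_simps)
  qed
  show ?thesis
    unfolding doubling_measure_on_def
  proof (intro conjI exI[of _ C] ballI allI impI sets_\<nu> C)
    fix x r :: real assume *: "x \<in> {0..1}" "0 < r"
    show "0 < emeasure \<nu> (?B x (2 * r))"
      using pos_ball[of x "2 * r"] * by (simp add: \<nu>.emeasure_eq_measure)
    show "emeasure \<nu> (?B x (2 * r)) \<le> ennreal C * emeasure \<nu> (?B x r)"
      using doubling[OF *] C by (simp add: \<nu>.emeasure_eq_measure flip: ennreal_mult)
    show "ennreal C * emeasure \<nu> (?B x r) < \<infinity>"
      using C by (simp add: \<nu>.emeasure_eq_measure flip: ennreal_mult)
  qed
qed

context uniform_cantor
begin

interpretation U: finite_measure unit_lebesgue by (rule finite_measure_unit_lebesgue)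

lemma level_subset_unit: "level k \<subseteq> {0..1}"
  using level_antimono[THEN decseqD, of 0 k] level_0 by simp

lemma I_subset_level: "w \<in> W k \<Longrightarrow> I w \<subseteq> level k"
  by (auto simp: cantor_level_def)

lemma lebesgue_I:
  assumes "w \<in> W k"
  shows "measure unit_lebesgue (I w) = level_length k"
proof -
  have "{0..1} \<inter> I w = I w" using I_subset_level[OF assms] level_subset_unit by blast
  then show ?thesis
    using word_ends_less[OF params, of w] right_minus_left[of w] length_W[OF assms]
    by (simp add: measure_unit_lebesgue I_eq)
qed

lemma lebesgue_level: "measure unit_lebesgue (level k) = real (card (W k)) * level_length k"
proof -
  have "measure unit_lebesgue (level k) = (\<Sum>w\<in>W k. measure unit_lebesgue (I w \<inter> level k))"
    by (intro measure_eq_sum_words U.finite_measure_axioms) auto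
  also have "\<dots> = (\<Sum>w\<in>W k. level_length k)"
    using I_subset_level lebesgue_I by (intro sum.cong) (auto simp: Int_absorb2)
  finally show ?thesis by simp
qed

lemma card_W_Suc: "card (W (Suc k)) = card (W k) * n (Suc k)"
proof -
  have "inj_on (\<lambda>(w, i). w @ [i]) (W k \<times> {1..n (Suc k)})" by (auto simp: inj_on_def)
  then show ?thesis unfolding words_Suc by (simp add: card_image card_cartesian_product)
qed

lemma lebesgue_level_eq_prod:
  "measure unit_lebesgue (level k) = (\<Prod>j<k. 1 - (real (n (Suc j)) - 1) * c (Suc j))"
proof (induction k)
  case 0
  then show ?case by (simp add: lebesgue_level words_0 level_length_0)
next
  case (Suc k)
  have "measure unit_lebesgue (level (Suc k)) =
      (1 - (real (n (Suc k)) - 1) * c (Suc k)) * measure unit_lebesgue (level k)"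
    using n_ge_2[of k] by (simp add: lebesgue_level card_W_Suc level_length_Suc field_simps)
  then show ?case using Suc by simp
qed

text \<open>The Lebesgue measure of \<open>E\<close> is an infinite product, nonzero because the removed
  proportions are summable and less than 1.\<close>

lemma lebesgue_E_pos:
  assumes "summable (\<lambda>k. real (n (Suc k)) * c (Suc k))"
  shows "0 < measure unit_lebesgue E"
proof -
  define f where "f k = (real (n (Suc k)) - 1) * c (Suc k)" for k
  have f: "0 < f k" "f k < 1" for k
    using removed_pos removed_less_1 by (auto simp: f_def)
  have "summable f"
    using assms
  proof (rule summable_comparison_test'[where N = 0])
    show "norm (f k) \<le> real (n (Suc k)) * c (Suc k)" for k
      using f(1)[of k] c_pos[of k] by (simp add: f_def algebra_simps)
  qed
  then have conv: "convergent_prod (\<lambda>k. 1 + (- f k))"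
    using f by (intro summable_imp_convergent_prod_real) (auto simp: less_imp_neq abs_of_pos)
  have "(\<lambda>k. measure unit_lebesgue (level (Suc k))) \<longlonglongrightarrow> prodinf (\<lambda>k. 1 + (- f k))"
    using convergent_prod_LIMSEQ[OF conv]
    by (simp add: lebesgue_level_eq_prod f_def lessThan_Suc_atMost)
  moreover have "(\<lambda>k. measure unit_lebesgue (level k)) \<longlonglongrightarrow> measure unit_lebesgue E"
    unfolding uniform_cantor_set_def
    using level_antimono by (intro U.finite_Lim_measure_decseq) auto
  ultimately have "measure unit_lebesgue E = prodinf (\<lambda>k. 1 + (- f k))"
    by (intro LIMSEQ_unique[OF LIMSEQ_Suc])
  moreover have "prodinf (\<lambda>k. 1 + (- f k)) \<noteq> 0"
    using conv f by (intro prodinf_nonzero) (auto simp: less_imp_neq)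
  ultimately show ?thesis using measure_nonneg[of unit_lebesgue E] by linarith
qed

text \<open>
  Components of one level are translates of each other together with everything inside them. The
  induction on the number of levels below them yields the equality of measures without exhibiting
  the translation.
\<close>

lemma lebesgue_I_Int_level_eq:
  assumes "v \<in> W k" "w \<in> W k"
  shows "measure unit_lebesgue (I v \<inter> level (k + j)) = measure unit_lebesgue (I w \<inter> level (k + j))"
  using assms
proof (induction j arbitrary: v w k)
  case 0
  then show ?case using I_subset_level lebesgue_I by (simp add: Int_absorb2)
next
  case (Suc j)
  have "level (k + Suc j) \<subseteq> level (Suc k)" using level_antimono by (rule decseqD) simp
  then have "measure unit_lebesgue (I u \<inter> level (k + Suc j)) =
      (\<Sum>i\<in>{1..n (Suc k)}. measure unit_lebesgue (I (u @ [i]) \<inter> level (k + Suc j)))"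
    if "u \<in> W k" for u
    using that by (intro measure_eq_sum_children U.finite_measure_axioms) auto
  moreover have "measure unit_lebesgue (I (v @ [i]) \<inter> level (k + Suc j)) =
      measure unit_lebesgue (I (w @ [i]) \<inter> level (k + Suc j))" if "i \<in> {1..n (Suc k)}" for i
    using Suc.IH[OF W_snoc[OF Suc.prems(1) that] W_snoc[OF Suc.prems(2) that]] by simp
  ultimately show ?case using Suc.prems by simp
qed

lemma lebesgue_I_Int_E_eq:
  assumes "v \<in> W k" "w \<in> W k"
  shows "measure unit_lebesgue (I v \<inter> E) = measure unit_lebesgue (I w \<inter> E)"
proof -
  have "(\<lambda>j. measure unit_lebesgue (I u \<inter> level (k + j))) \<longlonglongrightarrow> measure unit_lebesgue (I u \<inter> E)" for u
  proof -
    have "decseq (\<lambda>j. I u \<inter> level j)" using level_antimono by (auto simp: decseq_def)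
    then have "(\<lambda>j. measure unit_lebesgue (I u \<inter> level j)) \<longlonglongrightarrow> measure unit_lebesgue (\<Inter>j. I u \<inter> level j)"
      by (intro U.finite_Lim_measure_decseq) auto
    moreover have "(\<Inter>j. I u \<inter> level j) = I u \<inter> E" by (auto simp: uniform_cantor_set_def)
    ultimately show ?thesis using LIMSEQ_ignore_initial_segment[of _ _ k] by (simp add: add.commute)
  qed
  from this[of v] this[of w] show ?thesis
    using LIMSEQ_unique by (simp add: lebesgue_I_Int_level_eq[OF assms])
qed

text \<open>
  The parts of \<open>E\<close> in the children of a component have equal Lebesgue measures, which add up to that
  of the part of \<open>E\<close> in the component. Summability makes these measures positive.
\<close>

lemma equidistributed_lebesgue:
  assumes "summable (\<lambda>k. real (n (Suc k)) * c (Suc k))"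
  shows "equidistributed_measure n c (density unit_lebesgue (indicator E)) K"
proof -
  let ?L = "density unit_lebesgue (indicator E)"
  have em: "emeasure ?L A = emeasure unit_lebesgue (E \<inter> A)" if "A \<in> sets borel" for A
    using that by (intro emeasure_restricted) auto
  have m: "measure ?L A = measure unit_lebesgue (A \<inter> E)" if "A \<in> sets borel" for A
    using em[OF that] by (simp add: measure_def Int_commute)
  interpret L: finite_measure ?L
    by (rule finite_measureI) (use em[of UNIV] in auto)
  show ?thesis
  proof unfold_locales
    show "measure ?L (- E) = 0" by (simp add: m)
    show "measure ?L (I (w @ [i])) = measure ?L (I w) / real (n (Suc k))"
      if "K \<le> k" "w \<in> W k" "i \<in> {1..n (Suc k)}" for k w i
    proof -
      have "measure unit_lebesgue (I w \<inter> E) =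
          (\<Sum>j\<in>{1..n (Suc k)}. measure unit_lebesgue (I (w @ [j]) \<inter> E))"
        using that E_subset_level by (intro measure_eq_sum_children U.finite_measure_axioms) auto
      also have "\<dots> = (\<Sum>j\<in>{1..n (Suc k)}. measure unit_lebesgue (I (w @ [i]) \<inter> E))"
        using that by (intro sum.cong lebesgue_I_Int_E_eq[of _ "Suc k"] W_snoc) auto
      finally show ?thesis using n_ge_2[of k] by (simp add: m)
    qed
    show "0 < measure ?L (I w)" if w: "w \<in> W K" for w
    proof -
      have "0 < measure unit_lebesgue E" by (rule lebesgue_E_pos) fact
      also have "\<dots> = (\<Sum>v\<in>W K. measure unit_lebesgue (I v \<inter> E))"
        using E_subset_level by (intro measure_eq_sum_words U.finite_measure_axioms) auto
      also have "\<dots> = (\<Sum>v\<in>W K. measure unit_lebesgue (I w \<inter> E))"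
        using w by (intro sum.cong lebesgue_I_Int_E_eq) auto
      finally show ?thesis by (simp add: m zero_less_mult_iff)
    qed
  qed auto
qed

text \<open>
  The extension is \<open>\<nu>(A) = M(A) + \<lambda>(A - E)\<close>. Off \<open>E\<close> it is Lebesgue measure \<open>\<lambda>\<close>, and on \<open>E\<close> it is
  comparable to \<open>\<lambda>\<close>, as both are equidistributed.
\<close>

lemma doubling_extension_if_summable:
  assumes sum: "summable (\<lambda>k. real (n (Suc k)) * c (Suc k))"
    and M: "equidistributed_measure n c M K"
  obtains \<nu> where "doubling_measure_on {0..1} \<nu>"
    "\<And>A. \<lbrakk>A \<in> sets borel; A \<subseteq> E\<rbrakk> \<Longrightarrow> emeasure \<nu> A = emeasure M A"
proof -
  let ?L = "density unit_lebesgue (indicator E)"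
  let ?G = "density unit_lebesgue (indicator (- E))"
  interpret M: equidistributed_measure n c M K by fact
  have L: "equidistributed_measure n c ?L K" by (rule equidistributed_lebesgue[OF sum])
  obtain a where a: "0 \<le> a" "\<And>A. A \<in> sets borel \<Longrightarrow> measure M A \<le> a * measure ?L A"
    using equidistributed_measures_comparable[OF M L] by blast
  obtain b where b: "0 \<le> b" "\<And>A. A \<in> sets borel \<Longrightarrow> measure ?L A \<le> b * measure M A"
    using equidistributed_measures_comparable[OF L M] by blast
  have dens: "emeasure (density unit_lebesgue (indicator S)) A = emeasure unit_lebesgue (S \<inter> A)"
    if "A \<in> sets borel" "S \<in> sets borel" for A S
    using that by (intro emeasure_restricted) auto
  have splitL: "measure unit_lebesgue A = measure ?L A + measure ?G A" if A: "A \<in> sets borel" for A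
  proof -
    have "measure ?L A = measure unit_lebesgue (A \<inter> E)" "measure ?G A = measure unit_lebesgue (A - E)"
      using A by (auto simp: measure_def dens Int_commute Diff_eq)
    then show ?thesis using U.finite_measure_Diff'[of A E] A by simp
  qed
  have "sets ?G = sets M" by simp
  from ex_sum_measure[OF this] obtain S where S: "sets S = sets M"
    "\<And>A. A \<in> sets M \<Longrightarrow> emeasure S A = emeasure M A + emeasure ?G A"
    by blast
  interpret G: finite_measure ?G
    by (rule finite_measureI) (use dens[of UNIV "- E"] in auto)
  define \<nu> where "\<nu> = restrict_space S {0..1}"
  have em: "emeasure \<nu> A = emeasure M A + emeasure ?G A" if "A \<in> sets borel" "A \<subseteq> {0..1}" for A
    unfolding \<nu>_def using that S by (subst emeasure_restrict_space) auto
  have sets_\<nu>: "sets \<nu> = sets (restrict_space borel {0..1})"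
    unfolding \<nu>_def using S by (intro sets_restrict_space_cong) simp
  have space_\<nu>: "space \<nu> = {0..1}"
    using sets_eq_imp_space_eq[OF sets_\<nu>] by (simp add: space_restrict_space)
  have meas: "measure \<nu> A = measure M A + measure ?G A" if "A \<in> sets borel" "A \<subseteq> {0..1}" for A
    using em[OF that]
    by (intro measure_eq_emeasure_eq_ennreal)
      (simp_all add: M.emeasure_eq_measure G.emeasure_eq_measure flip: ennreal_plus)
  have fin: "finite_measure \<nu>"
    using em[of "{0..1}"] by (intro finite_measureI) (simp add: space_\<nu>)
  have "doubling_measure_on {0..1} \<nu>"
  proof (rule doubling_measure_if_comparable_to_lebesgue[OF sets_\<nu> fin, of "b + 1" "a + 1"])
    fix A :: "real set" assume A: "A \<in> sets borel" "A \<subseteq> {0..1}"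
    have nn: "0 \<le> measure M A" "0 \<le> measure ?G A" "0 \<le> measure ?L A" by simp_all
    show "measure unit_lebesgue A \<le> (b + 1) * measure \<nu> A"
      using b(2)[OF A(1)] nn mult_nonneg_nonneg[OF b(1) nn(2)]
      unfolding splitL[OF A(1)] meas[OF A] distrib_left distrib_right mult_1 by linarith
    show "measure \<nu> A \<le> (a + 1) * measure unit_lebesgue A"
      using a(2)[OF A(1)] nn mult_nonneg_nonneg[OF a(1) nn(2)]
      unfolding splitL[OF A(1)] meas[OF A] distrib_left distrib_right mult_1 by linarith
  qed (use a b in auto)
  moreover have "emeasure \<nu> A = emeasure M A" if "A \<in> sets borel" "A \<subseteq> E" for A
  proof -
    have "- E \<inter> A = {}" using that by auto
    then have "emeasure ?G A = 0" using dens[of A "- E"] that by simp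
    moreover have "A \<subseteq> {0..1}" using that E_subset_level[of 0] level_0 by auto
    ultimately show ?thesis using em[of A] that by simp
  qed
  ultimately show thesis using that by blast
qed

end

section \<open>The Cantor measure of an ultimately 1-uniform sequence\<close>

lemma equal_successive_imp_equal:
  assumes "\<And>i. Suc i < n \<Longrightarrow> f i = f (Suc i)" "i < n"
  shows "f i = f 0"
  using assms(2)
proof (induction i)
  case (Suc i)
  then show ?case using assms(1)[of i] by simp
qed simp

text \<open>Comparing the blocks of length 1 at adjacent positions shows that neighbouring entries
  agree.\<close>

lemma uniform_vector_1_nth:
  assumes "uniform_vector 1 p" and i: "i < length p"
  shows "p ! i = 1 / real (length p)"
proof -
  have pos: "p ! j > 0" if "j < length p" for j
    using assms that by (auto simp: uniform_vector_def positive_prob_vector_def)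
  have "p ! j = p ! Suc j" if "Suc j < length p" for j
  proof -
    have "inverse 1 \<le> (\<Sum>m\<in>{j..<j + 1}. p ! m) / (\<Sum>m\<in>{Suc j..<Suc j + 1}. p ! m) \<and>
          (\<Sum>m\<in>{j..<j + 1}. p ! m) / (\<Sum>m\<in>{Suc j..<Suc j + 1}. p ! m) \<le> 1"
      using assms(1)[unfolded uniform_vector_def, THEN conjunct2, THEN conjunct2,
          rule_format, of 1 j "Suc j"] that by simp
    then have "1 \<le> p ! j / p ! Suc j \<and> p ! j / p ! Suc j \<le> 1" by simp
    then have "p ! j / p ! Suc j = 1" by linarith
    then show ?thesis by (metis divide_eq_1_iff)
  qed
  then have eq: "p ! j = p ! 0" if "j < length p" for j
    using equal_successive_imp_equal[of "length p" "\<lambda>j. p ! j" j] that by blast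
  have "1 = (\<Sum>j<length p. p ! j)"
    using assms(1) by (simp add: uniform_vector_def positive_prob_vector_def sum_list_sum_nth atLeast0LessThan)
  also have "\<dots> = (\<Sum>j<length p. p ! 0)" using eq by (intro sum.cong) auto
  finally have "1 = real (length p) * p ! 0" by simp
  moreover have "length p > 0" using i by linarith
  ultimately show ?thesis using eq[OF i] by (simp add: field_simps)
qed

context uniform_cantor
begin

text \<open>
  The measure \<open>\<mu>\<close> has the subspace \<open>E\<close> as its space; \<open>distr\<close> along the inclusion makes it a Borel
  measure on the line. Positivity of the vectors, including those before \<open>K\<close>, makes every component
  of positive mass.
\<close>

lemma equidistributed_cantor_measure:
  assumes P: "matching n P" and unif: "\<And>k. Suc K \<le> k \<Longrightarrow> uniform_vector 1 (P k)"
    and \<mu>: "is_cantor_measure n c P \<mu>"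
  shows "equidistributed_measure n c (distr \<mu> borel (\<lambda>x. x)) K"
    and "A \<in> sets borel \<Longrightarrow> emeasure (distr \<mu> borel (\<lambda>x. x)) A = emeasure \<mu> (A \<inter> E)"
proof -
  let ?M = "distr \<mu> borel (\<lambda>x. x)"
  have sets_\<mu>: "sets \<mu> = sets (restrict_space borel E)" and prob: "prob_space \<mu>"
    using \<mu> by (auto simp: is_cantor_measure_def)
  have space_\<mu>: "space \<mu> = E"
    using sets_eq_imp_space_eq[OF sets_\<mu>] by (simp add: space_restrict_space)
  have meas: "(\<lambda>x. x) \<in> measurable \<mu> borel"
    unfolding measurable_cong_sets[OF sets_\<mu> refl] by (intro measurable_restrict_space1) simp
  show em: "emeasure ?M A = emeasure \<mu> (A \<inter> E)" if "A \<in> sets borel" for A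
    using that meas by (simp add: emeasure_distr space_\<mu>)
  interpret \<mu>: prob_space \<mu> by fact
  interpret M: prob_space ?M by (rule \<mu>.prob_space_distr[OF meas])
  have P_pos: "0 < P (Suc k) ! (i - 1)" if i: "i \<in> {1..n (Suc k)}" for k i
  proof -
    have "positive_prob_vector (P (Suc k))" "length (P (Suc k)) = n (Suc k)"
      using P by (auto simp: matching_def)
    moreover have "i - 1 < n (Suc k)" using i by auto
    ultimately show ?thesis by (auto simp: positive_prob_vector_def)
  qed
  have child: "measure ?M (I (w @ [i])) = P (Suc k) ! (i - 1) * measure ?M (I w)"
    if "w \<in> W k" "i \<in> {1..n (Suc k)}" for k w i
  proof -
    have "\<forall>k\<ge>1. \<forall>w\<in>W (k - 1). \<forall>i\<in>{1..n k}.
        emeasure \<mu> (I (w @ [i]) \<inter> E) = ennreal (P k ! (i - 1)) * emeasure \<mu> (I w \<inter> E)"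
      using \<mu> by (simp add: is_cantor_measure_def)
    then have "emeasure \<mu> (I (w @ [i]) \<inter> E) = ennreal (P (Suc k) ! (i - 1)) * emeasure \<mu> (I w \<inter> E)"
      using that by force
    then have "measure \<mu> (I (w @ [i]) \<inter> E) = enn2real (ennreal (P (Suc k) ! (i - 1))) * measure \<mu> (I w \<inter> E)"
      by (simp add: measure_def enn2real_mult)
    moreover have "0 \<le> P (Suc k) ! (i - 1)" using P_pos[OF that(2)] by simp
    ultimately show ?thesis by (simp add: measure_def em)
  qed
  have pos: "0 < measure ?M (I w)" if "w \<in> W k" for k w
    using that
  proof (induction k arbitrary: w)
    case 0
    have "I [] \<inter> E = E" using E_subset_level[of 0] by (auto simp: cantor_level_def words_0)
    then show ?case
      using 0 \<mu>.emeasure_space_1 by (simp add: words_0 measure_def em space_\<mu>)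
  next
    case (Suc k)
    then obtain v i where v: "w = v @ [i]" "v \<in> W k" "i \<in> {1..n (Suc k)}"
      unfolding words_Suc by auto
    then show ?case
      using P_pos[OF v(3)] Suc.IH[OF v(2)] child[OF v(2,3)] v(1) by simp
  qed
  show "equidistributed_measure n c ?M K"
  proof unfold_locales
    show "measure ?M (- E) = 0" by (simp add: measure_def em)
    show "measure ?M (I (w @ [i])) = measure ?M (I w) / real (n (Suc k))"
      if "K \<le> k" "w \<in> W k" "i \<in> {1..n (Suc k)}" for k w i
      using child[OF that(2,3)] uniform_vector_1_nth[OF unif, of "Suc k" "i - 1"] that P
      by (auto simp: matching_def)
    show "0 < measure ?M (I w)" if "w \<in> W K" for w using pos[OF that] .
  qed simp
qed

end

theorem theorem3:
  fixes n :: "nat \<Rightarrow> nat" and c :: "nat \<Rightarrow> real"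
    and P :: "nat \<Rightarrow> real list" and \<mu> :: "real measure"
  assumes "uniform_cantor_params n c"
    and "matching n P"
    and "ultimately_uniform 1 P"
    and "is_cantor_measure n c P \<mu>"
  shows "extends_to_doubling_measure (uniform_cantor_set n c) \<mu> \<longleftrightarrow>
         in_l1 (\<lambda>k. real (n k) * c k)"
proof -
  interpret uniform_cantor n c by (unfold_locales) fact
  obtain k0 where k0: "1 \<le> k0" "\<And>k. k0 \<le> k \<Longrightarrow> uniform_vector 1 (P k)"
    using assms(3) by (auto simp: ultimately_uniform_def)
  define K where "K = k0 - 1"
  define M where "M = distr \<mu> borel (\<lambda>x. x)"
  have unif: "uniform_vector 1 (P k)" if "Suc K \<le> k" for k
    using k0 that by (simp add: K_def)
  have M: "equidistributed_measure n c M K"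
    and em: "\<And>A. A \<in> sets borel \<Longrightarrow> emeasure M A = emeasure \<mu> (A \<inter> E)"
    using equidistributed_cantor_measure[OF assms(2) unif assms(4)] by (auto simp: M_def)
  interpret M: equidistributed_measure n c M K by fact
  have sets_\<mu>: "sets \<mu> = sets (restrict_space borel E)" and prob: "prob_space \<mu>"
    using assms(4) by (auto simp: is_cantor_measure_def)
  have "E \<subseteq> {0..1}" using E_subset_level[of 0] level_0 by simp
  have l1: "in_l1 (\<lambda>k. real (n k) * c k) \<longleftrightarrow> summable (\<lambda>k. real (n (Suc k)) * c (Suc k))"
    using c_pos by (simp add: in_l1_def abs_mult abs_of_pos)
  show ?thesis
    unfolding l1
  proof
    assume "extends_to_doubling_measure E \<mu>"
    then obtain \<nu> where \<nu>: "doubling_measure_on {0..1} \<nu>" and \<mu>: "restrict_space \<nu> E = \<mu>"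
      by (auto simp: extends_to_doubling_measure_def)
    have sets_\<nu>: "sets \<nu> = sets (restrict_space borel {0..1})"
      using \<nu> by (simp add: doubling_measure_on_def)
    then have space_\<nu>: "space \<nu> = {0..1}"
      using sets_eq_imp_space_eq[OF sets_\<nu>] by (simp add: space_restrict_space)
    have E_\<nu>: "E \<inter> space \<nu> \<in> sets \<nu>"
      unfolding sets_\<nu> space_\<nu> using \<open>E \<subseteq> {0..1}\<close> by (subst sets_restrict_space_iff) auto
    have "measure \<nu> (A \<inter> E) = measure M A" if "A \<in> sets borel" for A
      using em[OF that] measure_restrict_space[OF E_\<nu>, of "A \<inter> E"] \<mu> by (simp add: measure_def)
    moreover have "measure M UNIV = 1"
    proof -
      have "space \<mu> = E"
        using sets_eq_imp_space_eq[OF sets_\<mu>] by (simp add: space_restrict_space)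
      then show ?thesis using em[of UNIV] prob_space.emeasure_space_1[OF prob] by (simp add: measure_def)
    qed
    ultimately show "summable (\<lambda>k. real (n (Suc k)) * c (Suc k))"
      by (rule M.summable_if_doubling_extension[OF \<nu>])
  next
    assume "summable (\<lambda>k. real (n (Suc k)) * c (Suc k))"
    then obtain \<nu> where \<nu>: "doubling_measure_on {0..1} \<nu>"
      and ext: "\<And>A. \<lbrakk>A \<in> sets borel; A \<subseteq> E\<rbrakk> \<Longrightarrow> emeasure \<nu> A = emeasure M A"
      using doubling_extension_if_summable[OF _ M] by blast
    have sets_\<nu>: "sets \<nu> = sets (restrict_space borel {0..1})"
      using \<nu> by (simp add: doubling_measure_on_def)
    then have space_\<nu>: "space \<nu> = {0..1}"
      using sets_eq_imp_space_eq[OF sets_\<nu>] by (simp add: space_restrict_space)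
    have E_\<nu>: "E \<inter> space \<nu> \<in> sets \<nu>"
      unfolding sets_\<nu> space_\<nu> using \<open>E \<subseteq> {0..1}\<close> by (subst sets_restrict_space_iff) auto
    have "restrict_space \<nu> E = \<mu>"
    proof (rule measure_eqI)
      show sets: "sets (restrict_space \<nu> E) = sets \<mu>"
        unfolding sets_\<mu> sets_restrict_space_cong[OF sets_\<nu>]
        using \<open>E \<subseteq> {0..1}\<close> by (simp add: restrict_restrict_space Int_absorb1)
      fix A assume "A \<in> sets (restrict_space \<nu> E)"
      then have A: "A \<in> sets borel" "A \<subseteq> E"
        unfolding sets sets_\<mu> by (auto simp: sets_restrict_space_iff)
      then show "emeasure (restrict_space \<nu> E) A = emeasure \<mu> A"
        by (simp add: emeasure_restrict_space[OF E_\<nu>] ext em Int_absorb2)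
    qed
    then show "extends_to_doubling_measure E \<mu>"
      using \<nu> by (auto simp: extends_to_doubling_measure_def)
  qed
qed

end
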